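(* Let $\Sigma$ be a finite set of linear dependencies and $Q$ a safe BUCQ, both fixed. Deciding, given a database $\mathcal{D}$, whether $\langle\Sigma,\mathcal{D}\rangle$ IAR-entails $Q$ is in PTIME with respect to data complexity.
   Context: A signature is a set of predicate symbols with arities, always containing a special 0-ary predicate $\bot$. A term is a constant or a variable; a (predicate) atom is $p(t_1,\dots,t_n)$; an inequality is $t\neq t'$. A database is a finite set of ground atoms (facts) not containing $\bot$. A conjunction with inequalities is a conjunction of at least one predicate atom or inequality. A CQ is $\exists\vec y\,\gamma$ with $\gamma$ a conjunction with inequalities; it is safe if every variable occurs in a predicate atom; a UCQ is a finite disjunction of CQs; a safe BUCQ is a UCQ without free variables all of whose CQs are safe. A dependency is a first-order sentence $\forall\vec x\,(\gamma\rightarrow Q')$ where $\gamma$ (the body) is a conjunction with inequalities whose variables are in $\vec x$, each occurring in some predicate atom of $\gamma$, and $Q'$ (the head) is a UCQ whose free variables are among $\vec x$ and in which every existentially quantified variable of each disjunct occurs in a predicate atom of that disjunct. A dependency is linear if its body contains exactly one predicate atom. $\mathcal{D}$ is consistent with $\Sigma$ if $\mathcal{D}$ satisfies every dependency of $\Sigma$. A repair of $\langle\Sigma,\mathcal{D}\rangle$ is an inclusion-maximal subset of $\mathcal{D}$ consistent with $\Sigma$. $\langle\Sigma,\mathcal{D}\rangle$ IAR-entails $Q$ if the intersection of all repairs satisfies $Q$. *)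

theory Defs
  imports Main
begin

text \<open>Constants and variables are natural numbers; a predicate is either the special
  0-ary predicate Bot or a named predicate Pr p, whose arity is given by a signature
  function ar.\<close>

datatype trm = Cst nat | Var nat

datatype pred = Bot | Pr nat

datatype lit = Atm pred "trm list" | Neq trm trm

type_synonym conj = "lit list"
type_synonym cq = "nat list \<times> conj"           \<comment> \<open>(y, gamma) stands for EX y. gamma\<close>
type_synonym ucq = "cq list"
type_synonym dep = "conj \<times> ucq"               \<comment> \<open>(gamma, Q') stands for ALL x. gamma --> Q'\<close>

type_synonym fact = "pred \<times> nat list"

fun vars_trm :: "trm \<Rightarrow> nat set" where
  "vars_trm (Cst c) = {}"
| "vars_trm (Var v) = {v}"

fun vars_lit :: "lit \<Rightarrow> nat set" where
  "vars_lit (Atm p ts) = (\<Union>t\<in>set ts. vars_trm t)"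
| "vars_lit (Neq t u) = vars_trm t \<union> vars_trm u"

fun is_atom :: "lit \<Rightarrow> bool" where
  "is_atom (Atm p ts) = True"
| "is_atom (Neq t u) = False"

definition vars_conj :: "conj \<Rightarrow> nat set" where
  "vars_conj g = (\<Union>l\<in>set g. vars_lit l)"

definition atom_vars :: "conj \<Rightarrow> nat set" where
  "atom_vars g = (\<Union>l\<in>set g. if is_atom l then vars_lit l else {})"

definition fv_cq :: "cq \<Rightarrow> nat set" where
  "fv_cq q = vars_conj (snd q) - set (fst q)"

definition fv_ucq :: "ucq \<Rightarrow> nat set" where
  "fv_ucq Q = (\<Union>q\<in>set Q. fv_cq q)"

fun wf_lit :: "(nat \<Rightarrow> nat) \<Rightarrow> lit \<Rightarrow> bool" where
  "wf_lit ar (Atm Bot ts) = (ts = [])"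
| "wf_lit ar (Atm (Pr p) ts) = (length ts = ar p)"
| "wf_lit ar (Neq t u) = True"

definition wf_conj :: "(nat \<Rightarrow> nat) \<Rightarrow> conj \<Rightarrow> bool" where
  "wf_conj ar g \<longleftrightarrow> g \<noteq> [] \<and> (\<forall>l\<in>set g. wf_lit ar l)"

definition wf_cq :: "(nat \<Rightarrow> nat) \<Rightarrow> cq \<Rightarrow> bool" where
  "wf_cq ar q \<longleftrightarrow> wf_conj ar (snd q)"

definition wf_ucq :: "(nat \<Rightarrow> nat) \<Rightarrow> ucq \<Rightarrow> bool" where
  "wf_ucq ar Q \<longleftrightarrow> Q \<noteq> [] \<and> (\<forall>q\<in>set Q. wf_cq ar q)"

definition safe_cq :: "cq \<Rightarrow> bool" where
  "safe_cq q \<longleftrightarrow> vars_conj (snd q) \<subseteq> atom_vars (snd q)"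

definition safe_bucq :: "(nat \<Rightarrow> nat) \<Rightarrow> ucq \<Rightarrow> bool" where
  "safe_bucq ar Q \<longleftrightarrow> wf_ucq ar Q \<and> fv_ucq Q = {} \<and> (\<forall>q\<in>set Q. safe_cq q)"

text \<open>Dependency: every body variable occurs in a predicate atom of the body; every
  existentially quantified variable of each head disjunct occurs in a predicate atom of
  that disjunct.  The universally quantified variables x are all variables of the body
  together with the free variables of the head (semantically all are universally
  quantified, see dep_sat).\<close>
definition wf_dep :: "(nat \<Rightarrow> nat) \<Rightarrow> dep \<Rightarrow> bool" where
  "wf_dep ar d \<longleftrightarrow> wf_conj ar (fst d) \<and> vars_conj (fst d) \<subseteq> atom_vars (fst d)
     \<and> wf_ucq ar (snd d) \<and> (\<forall>q\<in>set (snd d). set (fst q) \<subseteq> atom_vars (snd q))"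

definition linear_dep :: "dep \<Rightarrow> bool" where
  "linear_dep d \<longleftrightarrow> length (filter is_atom (fst d)) = 1"

fun eval_trm :: "(nat \<Rightarrow> nat) \<Rightarrow> trm \<Rightarrow> nat" where
  "eval_trm \<nu> (Cst c) = c"
| "eval_trm \<nu> (Var v) = \<nu> v"

fun holds_lit :: "fact set \<Rightarrow> (nat \<Rightarrow> nat) \<Rightarrow> lit \<Rightarrow> bool" where
  "holds_lit D \<nu> (Atm p ts) = ((p, map (eval_trm \<nu>) ts) \<in> D)"
| "holds_lit D \<nu> (Neq t u) = (eval_trm \<nu> t \<noteq> eval_trm \<nu> u)"

definition holds_conj :: "fact set \<Rightarrow> (nat \<Rightarrow> nat) \<Rightarrow> conj \<Rightarrow> bool" where
  "holds_conj D \<nu> g \<longleftrightarrow> (\<forall>l\<in>set g. holds_lit D \<nu> l)"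

definition holds_cq :: "fact set \<Rightarrow> (nat \<Rightarrow> nat) \<Rightarrow> cq \<Rightarrow> bool" where
  "holds_cq D \<nu> q \<longleftrightarrow> (\<exists>\<mu>. (\<forall>v. v \<notin> set (fst q) \<longrightarrow> \<mu> v = \<nu> v) \<and> holds_conj D \<mu> (snd q))"

definition holds_ucq :: "fact set \<Rightarrow> (nat \<Rightarrow> nat) \<Rightarrow> ucq \<Rightarrow> bool" where
  "holds_ucq D \<nu> Q \<longleftrightarrow> (\<exists>q\<in>set Q. holds_cq D \<nu> q)"

text \<open>Satisfaction of a Boolean UCQ (no free variables, so the assignment is irrelevant).\<close>
definition sat_bucq :: "fact set \<Rightarrow> ucq \<Rightarrow> bool" where
  "sat_bucq D Q \<longleftrightarrow> holds_ucq D (\<lambda>_. 0) Q"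

definition dep_sat :: "fact set \<Rightarrow> dep \<Rightarrow> bool" where
  "dep_sat D d \<longleftrightarrow> (\<forall>\<nu>. holds_conj D \<nu> (fst d) \<longrightarrow> holds_ucq D \<nu> (snd d))"

definition consistent :: "dep set \<Rightarrow> fact set \<Rightarrow> bool" where
  "consistent \<Sigma> D \<longleftrightarrow> (\<forall>d\<in>\<Sigma>. dep_sat D d)"

definition is_repair :: "dep set \<Rightarrow> fact set \<Rightarrow> fact set \<Rightarrow> bool" where
  "is_repair \<Sigma> D R \<longleftrightarrow> R \<subseteq> D \<and> consistent \<Sigma> R
     \<and> (\<forall>R'. R \<subset> R' \<and> R' \<subseteq> D \<longrightarrow> \<not> consistent \<Sigma> R')"

definition IAR_entails :: "dep set \<Rightarrow> fact set \<Rightarrow> ucq \<Rightarrow> bool" where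
  "IAR_entails \<Sigma> D Q \<longleftrightarrow> sat_bucq (\<Inter>{R. is_repair \<Sigma> D R}) Q"

text \<open>An input database is given as a list of facts (p, cs), meaning the ground atom
  Pr p (cs); it must respect the arities.  It never contains Bot.\<close>
definition wf_db_list :: "(nat \<Rightarrow> nat) \<Rightarrow> (nat \<times> nat list) list \<Rightarrow> bool" where
  "wf_db_list ar fs \<longleftrightarrow> (\<forall>(p, cs)\<in>set fs. length cs = ar p)"

definition db_of :: "(nat \<times> nat list) list \<Rightarrow> fact set" where
  "db_of fs = (\<lambda>(p, cs). (Pr p, cs)) ` set fs"

text \<open>Binary encoding over the input alphabet {1,2,3,4}: 1 = bit 0, 2 = bit 1
  (little endian, no trailing zero bits), 3 = separator of arguments, 4 = end of fact.\<close>
fun bin :: "nat \<Rightarrow> nat list" where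
  "bin n = (if n = 0 then [] else (n mod 2 + 1) # bin (n div 2))"

definition enc_fact :: "nat \<times> nat list \<Rightarrow> nat list" where
  "enc_fact f = bin (fst f) @ concat (map (\<lambda>c. 3 # bin c) (snd f)) @ [4]"

definition enc_db :: "(nat \<times> nat list) list \<Rightarrow> nat list" where
  "enc_db fs = concat (map enc_fact fs)"

datatype dir = Lt | Rt | Stay

text \<open>States are 0..<nstates (start state 0), tape symbols 0..<nsyms (blank 0).\<close>
record tm =
  nstates :: nat
  nsyms :: nat
  delta :: "nat \<Rightarrow> nat \<Rightarrow> nat \<times> nat \<times> dir"
  acc_st :: nat
  rej_st :: nat

definition wf_tm :: "tm \<Rightarrow> bool" where
  "wf_tm M \<longleftrightarrow> 0 < nstates M \<and> acc_st M < nstates M \<and> rej_st M < nstates M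
     \<and> acc_st M \<noteq> rej_st M \<and> 5 \<le> nsyms M
     \<and> (\<forall>q a. q < nstates M \<and> a < nsyms M \<longrightarrow>
           fst (delta M q a) < nstates M \<and> fst (snd (delta M q a)) < nsyms M)"

text \<open>Configuration: (state, tape left of head in reverse order, tape from head on).\<close>
type_synonym config = "nat \<times> nat list \<times> nat list"

fun step :: "tm \<Rightarrow> config \<Rightarrow> config" where
  "step M (q, ls, rs) =
     (if q = acc_st M \<or> q = rej_st M then (q, ls, rs)
      else (let a = (case rs of [] \<Rightarrow> 0 | x # _ \<Rightarrow> x);
                (q', b, d) = delta M q a
            in case d of
                 Stay \<Rightarrow> (q', ls, b # tl rs)
               | Rt \<Rightarrow> (q', b # ls, tl rs)
               | Lt \<Rightarrow> (case ls of [] \<Rightarrow> (q', [], b # tl rs)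
                                 | x # ls' \<Rightarrow> (q', ls', x # b # tl rs))))"

definition run :: "tm \<Rightarrow> nat \<Rightarrow> config \<Rightarrow> config" where
  "run M t c = (step M ^^ t) c"

definition IAR_in_PTIME_data :: "(nat \<Rightarrow> nat) \<Rightarrow> dep set \<Rightarrow> ucq \<Rightarrow> bool" where
  "IAR_in_PTIME_data ar \<Sigma> Q \<longleftrightarrow>
     (\<exists>M c k. wf_tm M \<and>
       (\<forall>fs. wf_db_list ar fs \<longrightarrow>
          (let w = enc_db fs; q = fst (run M (c * length w ^ k + c) (0, [], w))
           in (q = acc_st M \<or> q = rej_st M) \<and> (q = acc_st M \<longleftrightarrow> IAR_entails \<Sigma> (db_of fs) Q))))"

end

theory Submission
  imports Defs "HOL-Library.Nat_Bijection"
begin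

text \<open>A linear body is matched inside a single fact and heads are monotone, so consistent sets are
  closed under union and the repair is unique: it is reached by repeatedly deleting facts that
  violate a dependency. Whether a fact violates a dependency is a first-order question about the
  positions of the encoded database. Variables range over the constants of the database, those of
  the dependencies, and one fresh value; a single fresh value suffices because identifying unknown
  constants only falsifies inequalities of the head. Such questions, and the deletion loop, are
  answered by programs with finitely many pointers into the input. A pointer is a mark on a tape
  cell, so a program step is one sweep of a Turing machine over the input, and the only loops
  run once over all positions, which gives the polynomial time bound.\<close>

section \<open>Pointer programs\<close>

text \<open>One machine has to serve every database, so only finite data may enter its states: the
  dependencies, the query and the constants in them. Everything that grows with the input is kept in
  marks. Formulas stand between dependencies and programs in order to separate the question of truth
  from what an evaluation does to the tracks. Deletion never moves tape content; it only marks the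
  start of a fact as dead, so the formula for a violation is the same in every round and sees the
  current set through the predicate \<open>Dead\<close>. Universally quantified variables of a head
  need not occur in the body and thus range over all natural numbers; this unbounded range is what
  calls for the fresh value, which remains symbolic in the formulas because no fixed number is fresh
  for all inputs. The empty database gives the empty word, on which no cell can carry a mark, and is
  treated apart.\<close>

datatype prog =
    Sw "bool \<Rightarrow> nat \<Rightarrow> nat set \<Rightarrow> bool" nat "bool \<Rightarrow> nat \<Rightarrow> nat set \<Rightarrow> bool"
  | Cond prog prog prog
  | Any nat prog

type_synonym tracks = "nat \<Rightarrow> nat set"

definition marks :: "tracks \<Rightarrow> nat \<Rightarrow> nat set" where
  "marks \<sigma> i = {j. i \<in> \<sigma> j}"

text \<open>The state on arrival at cell \<open>i\<close>, before that cell is read. What a sweep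
  writes at a cell thus depends on the cells strictly to its left and on the old marks of the cell
  itself.\<close>

primrec st :: "(bool \<Rightarrow> nat \<Rightarrow> nat set \<Rightarrow> bool) \<Rightarrow> nat list \<Rightarrow> tracks \<Rightarrow> nat \<Rightarrow> bool" where
  "st g w \<sigma> 0 = False"
| "st g w \<sigma> (Suc i) = g (st g w \<sigma> i) (w ! i) (marks \<sigma> i)"

text \<open>A successful round leaves the loop at once with the tracks as they stand; exhausting the
  positions clears the pointer, just as a mark shifted off the end of the word disappears.\<close>

primrec iter :: "nat \<Rightarrow> (tracks \<Rightarrow> bool \<times> tracks) \<Rightarrow> nat list \<Rightarrow> tracks \<Rightarrow> bool \<times> tracks" where
  "iter x f [] \<sigma> = (False, \<sigma>(x := {}))"
| "iter x f (p # ps) \<sigma> =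
     (case f (\<sigma>(x := {p})) of (r, \<sigma>') \<Rightarrow> if r then (True, \<sigma>') else iter x f ps \<sigma>')"

primrec exec :: "nat list \<Rightarrow> prog \<Rightarrow> tracks \<Rightarrow> bool \<times> tracks" where
  "exec w (Sw g x h) = (\<lambda>\<sigma>. (st g w \<sigma> (length w),
     \<sigma>(x := {i. i < length w \<and> h (st g w \<sigma> i) (w ! i) (marks \<sigma> i)})))"
| "exec w (Cond P A B) = (\<lambda>\<sigma>. case exec w P \<sigma> of (r, \<sigma>') \<Rightarrow> if r then exec w A \<sigma>' else exec w B \<sigma>')"
| "exec w (Any x P) = (\<lambda>\<sigma>. iter x (exec w P) [0..<length w] \<sigma>)"

primrec writes :: "prog \<Rightarrow> nat set" where
  "writes (Sw g x h) = {x}"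
| "writes (Cond P A B) = writes P \<union> writes A \<union> writes B"
| "writes (Any x P) = insert x (writes P)"

text \<open>A loop has no counter besides its mark: the next round is found by shifting the mark on
  track \<open>x\<close>, so the body must not touch it.\<close>

primrec wf_prog :: "prog \<Rightarrow> bool" where
  "wf_prog (Sw g x h) = True"
| "wf_prog (Cond P A B) = (wf_prog P \<and> wf_prog A \<and> wf_prog B)"
| "wf_prog (Any x P) = (x \<notin> writes P \<and> wf_prog P)"

text \<open>A sweep takes \<open>n\<close> steps to the right, one on the blank and \<open>n\<close>
  for the way back. A loop pays one sweep to place its pointer and one shift per round.\<close>

primrec cost :: "nat \<Rightarrow> prog \<Rightarrow> nat" where
  "cost n (Sw g x h) = 2 * n + 1"
| "cost n (Cond P A B) = cost n P + cost n A + cost n B"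
| "cost n (Any x P) = (2 * n + 1) + n * (cost n P + (2 * n + 1))"

lemma finite_writes: "finite (writes P)"
  by (induction P) auto

lemma iter_unchanged:
  assumes "\<And>\<sigma>. snd (f \<sigma>) y = \<sigma> y" "y \<noteq> x"
  shows "snd (iter x f ps \<sigma>) y = \<sigma> y"
proof (induction ps arbitrary: \<sigma>)
  case Nil
  then show ?case using assms(2) by simp
next
  case (Cons p ps)
  obtain r \<sigma>' where e: "f (\<sigma>(x := {p})) = (r, \<sigma>')" by fastforce
  have "\<sigma>' y = \<sigma> y" using assms(1)[of "\<sigma>(x := {p})"] assms(2) e by simp
  then show ?case using e Cons[of \<sigma>'] by simp
qed

lemma exec_unchanged: "y \<notin> writes P \<Longrightarrow> snd (exec w P \<sigma>) y = \<sigma> y"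
proof (induction P arbitrary: \<sigma>)
  case (Cond P A B)
  obtain r \<sigma>' where e: "exec w P \<sigma> = (r, \<sigma>')" by fastforce
  show ?case using Cond.IH(1)[of \<sigma>] Cond.IH(2,3)[of \<sigma>'] Cond.prems e by simp
next
  case (Any x P)
  then show ?case using iter_unchanged[of "exec w P" y x] by auto
qed auto

text \<open>The exponent depends on the program alone, each loop adding 2 to it. The restriction to
  \<open>n \<ge> 1\<close> makes powers monotone in the exponent, so several bounds can be raised to
  a common one.\<close>

lemma cost_polynomial: "\<exists>c k. \<forall>n\<ge>1. cost n P \<le> c * n ^ k"
proof (induction P)
  case (Sw g x h)
  show ?case by (rule exI[of _ 3], rule exI[of _ 1]) auto
next
  case (Cond P A B)
  then obtain c1 k1 c2 k2 c3 k3 where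
    h: "\<forall>n\<ge>1. cost n P \<le> c1 * n ^ k1" "\<forall>n\<ge>1. cost n A \<le> c2 * n ^ k2" "\<forall>n\<ge>1. cost n B \<le> c3 * n ^ k3"
    by metis
  have "cost n (Cond P A B) \<le> (c1 + c2 + c3) * n ^ (k1 + k2 + k3)" if "n \<ge> 1" for n
  proof -
    have "n ^ k1 \<le> n ^ (k1 + k2 + k3)" "n ^ k2 \<le> n ^ (k1 + k2 + k3)" "n ^ k3 \<le> n ^ (k1 + k2 + k3)"
      using that by (intro power_increasing; simp)+
    then have "c1 * n ^ k1 \<le> c1 * n ^ (k1 + k2 + k3)" "c2 * n ^ k2 \<le> c2 * n ^ (k1 + k2 + k3)"
      "c3 * n ^ k3 \<le> c3 * n ^ (k1 + k2 + k3)"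
      using mult_le_mono2 by blast+
    moreover have "cost n P \<le> c1 * n ^ k1" "cost n A \<le> c2 * n ^ k2" "cost n B \<le> c3 * n ^ k3"
      using h that by auto
    ultimately show ?thesis unfolding cost.simps distrib_right by linarith
  qed
  then show ?case by blast
next
  case (Any x P)
  then obtain c k where h: "\<forall>n\<ge>1. cost n P \<le> c * n ^ k" by metis
  have "cost n (Any x P) \<le> (c + 6) * n ^ (k + 2)" if n: "n \<ge> 1" for n
  proof -
    have "n * cost n P \<le> n * (c * n ^ k)" using h n by simp
    also have "\<dots> = c * n ^ (k + 1)" by (simp add: algebra_simps)
    also have "\<dots> \<le> c * n ^ (k + 2)" using n by (intro mult_le_mono2 power_increasing) auto
    finally have 1: "n * cost n P \<le> c * n ^ (k + 2)" .
    have "n ^ 1 \<le> n ^ (k + 2)" "n ^ 2 \<le> n ^ (k + 2)" "n ^ 0 \<le> n ^ (k + 2)"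
      using n by (intro power_increasing; simp)+
    then have "n \<le> n ^ (k + 2)" "n * n \<le> n ^ (k + 2)" "1 \<le> n ^ (k + 2)"
      unfolding power2_eq_square power_one_right power_0 .
    \<comment> \<open>The left side is a sum of \<open>n * n\<close>, \<open>n\<close> and 1 with
      coefficients 2, 3 and 1, hence the 6.\<close>
    then have "2 * n + 1 + n * (2 * n + 1) \<le> 6 * n ^ (k + 2)"
      unfolding distrib_left mult.left_commute[of n 2] nat_mult_1_right by linarith
    then show ?thesis using 1 unfolding cost.simps distrib_left distrib_right by linarith
  qed
  then show ?case by blast
qed

section \<open>Compilation to Turing machines\<close>

text \<open>Factor 8 leaves room for the symbols 0 to 4. An unmarked cell is coded by its symbol
  itself, so the raw input already is a tape with empty tracks.\<close>

definition enc_cell :: "nat \<Rightarrow> nat set \<Rightarrow> nat" where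
  "enc_cell s X = s + 8 * set_encode X"

text \<open>States \<open>b\<close> and \<open>b + 1\<close> sweep to the right, \<open>b + 2\<close> and \<open>b + 3\<close> carry the answer back
  to the cell with mark 0.\<close>

definition sweep ::
  "(bool \<Rightarrow> nat \<Rightarrow> nat set \<Rightarrow> bool) \<Rightarrow> nat \<Rightarrow> (bool \<Rightarrow> nat \<Rightarrow> nat set \<Rightarrow> bool) \<Rightarrow>
   nat \<Rightarrow> nat \<Rightarrow> nat \<Rightarrow> nat \<Rightarrow> nat \<Rightarrow> nat \<times> nat \<times> dir" where
  "sweep g x h b kt kf q a =
     (let s = a mod 8; X = set_decode (a div 8); r = (q = b + 1) in
      if q < b + 2 then
        if a = 0 then (if r then b + 3 else b + 2, 0, Lt)
        else (if g r s X then b + 1 else b, enc_cell s (if h r s X then insert x X else X - {x}), Rt)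
      else if 0 \<in> X then (if q = b + 2 then kf else kt, a, Stay)
      else (q, a, Lt))"

primrec psize :: "prog \<Rightarrow> nat" where
  "psize (Sw g x h) = 4"
| "psize (Cond P A B) = psize P + psize A + psize B"
| "psize (Any x P) = 8 + psize P"

abbreviation init_sw :: "nat \<Rightarrow> prog" where
  "init_sw x \<equiv> Sw (\<lambda>_ _ _. True) x (\<lambda>q _ _. \<not> q)"

abbreviation shift_sw :: "nat \<Rightarrow> prog" where
  "shift_sw x \<equiv> Sw (\<lambda>_ _ X. x \<in> X) x (\<lambda>q _ _. q)"

text \<open>\<open>b\<close> is the first state, \<open>kt\<close> and \<open>kf\<close> are the
  exits. In a loop, four states place the pointer, four shift it, and the body starts at
  \<open>b + 8\<close>. A failing body continues with the shift, whose answer True means that the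
  mark was lost at the right end and hence that the loop fails.\<close>

primrec compile :: "prog \<Rightarrow> nat \<Rightarrow> nat \<Rightarrow> nat \<Rightarrow> nat \<Rightarrow> nat \<Rightarrow> nat \<times> nat \<times> dir" where
  "compile (Sw g x h) = sweep g x h"
| "compile (Cond P A B) = (\<lambda>b kt kf q.
     if q < b + psize P then compile P b (b + psize P) (b + psize P + psize A) q
     else if q < b + psize P + psize A then compile A (b + psize P) kt kf q
     else compile B (b + psize P + psize A) kt kf q)"
| "compile (Any x P) = (\<lambda>b kt kf q.
     if q < b + 4 then sweep (\<lambda>_ _ _. True) x (\<lambda>q _ _. \<not> q) b (b + 8) (b + 8) q
     else if q < b + 8 then sweep (\<lambda>_ _ X. x \<in> X) x (\<lambda>q _ _. q) (b + 4) kf (b + 8) q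
     else compile P (b + 8) kt (b + 4) q)"

section \<open>Finiteness of the state set and of the tape alphabet\<close>

lemma psize_pos: "0 < psize P"
  by (induction P) auto

lemma compile_state_bound:
  assumes "b + psize P \<le> N" "kt < N" "kf < N" "q < N"
  shows "fst (compile P b kt kf q a) < N"
  using assms
proof (induction P arbitrary: b kt kf)
  case (Sw g x h)
  then show ?case by (auto simp: sweep_def Let_def)
next
  case (Cond P A B)
  then show ?case using psize_pos[of A] psize_pos[of B] by auto
next
  case (Any x P)
  then show ?case using psize_pos[of P] by (auto simp: sweep_def Let_def)
qed

lemma set_decode_bound:
  assumes "n < 2 ^ K"
  shows "set_decode n \<subseteq> {..<K}"
proof
  fix j assume "j \<in> set_decode n"
  then have "odd (n div 2 ^ j)" by (simp add: set_decode_def)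
  then have "2 ^ j \<le> n" by (metis div_less even_zero not_less)
  then have "(2::nat) ^ j < 2 ^ K" using assms by (rule le_less_trans)
  then show "j \<in> {..<K}" using power_less_imp_less_exp[of "2::nat" j K] by simp
qed

lemma set_encode_bound:
  assumes "X \<subseteq> {..<K}"
  shows "set_encode X < 2 ^ K"
proof -
  have "set_encode X \<le> (\<Sum>i<K. 2 ^ i)"
    unfolding set_encode_def using assms by (intro sum_mono2) auto
  also have "\<dots> < (2::nat) ^ K" by (induction K) auto
  finally show ?thesis .
qed

lemma enc_cell_bound:
  assumes "s < 8" "X \<subseteq> {..<K}"
  shows "enc_cell s X < 8 * 2 ^ K"
proof -
  have "set_encode X + 1 \<le> 2 ^ K" using set_encode_bound[OF assms(2)] by simp
  then have "8 * (set_encode X + 1) \<le> 8 * 2 ^ K" by (rule mult_le_mono2)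
  then show ?thesis using assms(1) by (simp add: enc_cell_def)
qed

lemma enc_cell_mod: "s < 8 \<Longrightarrow> enc_cell s X mod 8 = s"
  by (simp add: enc_cell_def)

lemma enc_cell_div: "s < 8 \<Longrightarrow> finite X \<Longrightarrow> set_decode (enc_cell s X div 8) = X"
  by (simp add: enc_cell_def)

lemma sweep_symbol_bound:
  assumes "a < 8 * 2 ^ K" "x < K"
  shows "fst (snd (sweep g x h b kt kf q a)) < 8 * 2 ^ K"
proof -
  have "a div 8 < 2 ^ K" using assms(1) by (simp add: less_mult_imp_div_less mult.commute)
  then have X: "set_decode (a div 8) \<subseteq> {..<K}" by (rule set_decode_bound)
  have "enc_cell (a mod 8) (insert x (set_decode (a div 8))) < 8 * 2 ^ K"
    "enc_cell (a mod 8) (set_decode (a div 8) - {x}) < 8 * 2 ^ K"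
    using X assms(2) by (auto intro!: enc_cell_bound)
  then show ?thesis using assms(1) by (auto simp: sweep_def Let_def)
qed

lemma compile_symbol_bound:
  assumes "a < 8 * 2 ^ K" "writes P \<subseteq> {..<K}"
  shows "fst (snd (compile P b kt kf q a)) < 8 * 2 ^ K"
  using assms by (induction P arbitrary: b kt kf) (auto intro!: sweep_symbol_bound)

text \<open>Only an upper bound on the time is kept, since conditionals skip a branch and loops stop
  early.\<close>

definition reach :: "tm \<Rightarrow> config \<Rightarrow> nat \<Rightarrow> config \<Rightarrow> bool" where
  "reach M c t c' \<longleftrightarrow> (\<exists>T\<le>t. run M T c = c')"

lemma run_add: "run M (i + j) c = run M j (run M i c)"
  unfolding run_def by (metis add.commute comp_apply funpow_add)

lemma reach_trans: "reach M c t1 c' \<Longrightarrow> reach M c' t2 c'' \<Longrightarrow> reach M c (t1 + t2) c''"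
  unfolding reach_def by (metis add_mono run_add)

lemma reach_mono: "reach M c t c' \<Longrightarrow> t \<le> t' \<Longrightarrow> reach M c t' c'"
  unfolding reach_def using le_trans by blast

section \<open>Simulation of programs on the tape\<close>

locale word =
  fixes w :: "nat list"
  assumes w_ne: "w \<noteq> []" and w_sym: "s \<in> set w \<Longrightarrow> 0 < s \<and> s < 8"
begin

abbreviation n :: nat where "n \<equiv> length w"

lemma n_pos: "0 < n"
  using w_ne by simp

text \<open>Track 0 tells the returning head where the tape begins; empty tracks from
  \<open>K\<close> on keep the alphabet finite.\<close>

definition good :: "nat \<Rightarrow> tracks \<Rightarrow> bool" where
  "good K \<sigma> \<longleftrightarrow> \<sigma> 0 = {0} \<and> (\<forall>j. \<sigma> j \<subseteq> {..<n}) \<and> (\<forall>j\<ge>K. \<sigma> j = {})"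

lemma good_upd: "good K \<sigma> \<Longrightarrow> 0 < x \<Longrightarrow> x < K \<Longrightarrow> S \<subseteq> {..<n} \<Longrightarrow> good K (\<sigma>(x := S))"
  by (auto simp: good_def)

lemma good_iter:
  assumes "\<And>\<sigma>. good K \<sigma> \<Longrightarrow> good K (snd (f \<sigma>))" "0 < x" "x < K" "set ps \<subseteq> {..<n}" "good K \<sigma>"
  shows "good K (snd (iter x f ps \<sigma>))"
  using assms(4,5)
proof (induction ps arbitrary: \<sigma>)
  case Nil
  then show ?case unfolding iter.simps snd_conv using assms(2,3) by (intro good_upd) auto
next
  case (Cons p ps)
  have "good K (\<sigma>(x := {p}))" using good_upd assms(2,3) Cons.prems by simp
  from assms(1)[OF this] show ?case using Cons by (auto split: prod.splits)
qed

lemma good_exec: "writes P \<subseteq> {0<..<K} \<Longrightarrow> good K \<sigma> \<Longrightarrow> good K (snd (exec w P \<sigma>))"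
proof (induction P arbitrary: \<sigma>)
  case (Sw g x h)
  then show ?case unfolding exec.simps snd_conv by (intro good_upd) auto
next
  case (Cond P A B)
  obtain r \<sigma>' where e: "exec w P \<sigma> = (r, \<sigma>')" by fastforce
  show ?case using Cond.IH(1)[of \<sigma>] Cond.IH(2,3)[of \<sigma>'] Cond.prems e by simp
next
  case (Any x P)
  then show ?case by (auto intro!: good_iter)
qed

definition cells :: "tracks \<Rightarrow> nat list" where
  "cells \<sigma> = map (\<lambda>i. enc_cell (w ! i) (marks \<sigma> i)) [0..<n]"

lemma length_cells[simp]: "length (cells \<sigma>) = n"
  by (simp add: cells_def)

lemma nth_cells: "i < n \<Longrightarrow> cells \<sigma> ! i = enc_cell (w ! i) (marks \<sigma> i)"
  by (simp add: cells_def)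

lemma w_nth: "i < n \<Longrightarrow> 0 < w ! i \<and> w ! i < 8"
  using w_sym by auto

lemma marks_bound: "good K \<sigma> \<Longrightarrow> marks \<sigma> i \<subseteq> {..<K}"
  by (force simp: good_def marks_def)

lemma finite_marks: "good K \<sigma> \<Longrightarrow> finite (marks \<sigma> i)"
  by (rule finite_subset[OF marks_bound]) simp_all

lemma origin_mark: "good K \<sigma> \<Longrightarrow> 0 \<in> marks \<sigma> i \<longleftrightarrow> i = 0"
  by (auto simp: good_def marks_def)

text \<open>A left move at the end of the tape stays put without any signal, so the mark on track 0
  has to stop the head: \<open>i\<close> moves and one final stay.\<close>

lemma sim_return:
  assumes "i < n" "good K \<sigma>" "q \<noteq> acc_st M" "q \<noteq> rej_st M"
    and d: "\<And>a. delta M q a = (if 0 \<in> set_decode (a div 8) then (k, a, Stay) else (q, a, Lt))"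
  shows "run M (i + 1) (q, rev (take i (cells \<sigma>)), drop i (cells \<sigma>) @ z) = (k, [], cells \<sigma> @ z)"
  using assms(1)
proof (induction i)
  case 0
  have c: "cells \<sigma> = cells \<sigma> ! 0 # tl (cells \<sigma>)"
    using n_pos by (metis length_cells length_greater_0_conv hd_conv_nth list.collapse)
  have "set_decode (cells \<sigma> ! 0 div 8) = marks \<sigma> 0"
    using n_pos w_nth[of 0] finite_marks[OF assms(2)] by (simp add: nth_cells enc_cell_div)
  then have "delta M q (cells \<sigma> ! 0) = (k, cells \<sigma> ! 0, Stay)"
    using origin_mark[OF assms(2)] d by (simp del: set_decode_0)
  moreover obtain a r where ar: "cells \<sigma> = a # r" using c by blast
  ultimately show ?case using assms(3,4) by (simp add: run_def)
next
  case (Suc i)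
  have "set_decode (cells \<sigma> ! Suc i div 8) = marks \<sigma> (Suc i)"
    using Suc.prems w_nth[of "Suc i"] finite_marks[OF assms(2)] by (simp add: nth_cells enc_cell_div)
  then have e: "delta M q (cells \<sigma> ! Suc i) = (q, cells \<sigma> ! Suc i, Lt)"
    using origin_mark[OF assms(2)] d by (simp del: set_decode_0)
  have dr: "drop (Suc i) (cells \<sigma>) = cells \<sigma> ! Suc i # drop (Suc (Suc i)) (cells \<sigma>)"
    using Suc.prems by (simp add: Cons_nth_drop_Suc)
  have dr': "drop i (cells \<sigma>) = cells \<sigma> ! i # drop (Suc i) (cells \<sigma>)"
    using Suc.prems by (simp add: Cons_nth_drop_Suc)
  have tk: "rev (take (Suc i) (cells \<sigma>)) = cells \<sigma> ! i # rev (take i (cells \<sigma>))"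
    using Suc.prems by (simp add: take_Suc_conv_app_nth)
  have "step M (q, rev (take (Suc i) (cells \<sigma>)), drop (Suc i) (cells \<sigma>) @ z)
      = (q, rev (take i (cells \<sigma>)), drop i (cells \<sigma>) @ z)"
    unfolding tk unfolding dr' unfolding dr using e assms(3,4) by simp
  then have "run M (1 + (i + 1)) (q, rev (take (Suc i) (cells \<sigma>)), drop (Suc i) (cells \<sigma>) @ z)
     = run M (i + 1) (q, rev (take i (cells \<sigma>)), drop i (cells \<sigma>) @ z)"
    unfolding run_add by (simp add: run_def)
  then show ?case using Suc by simp
qed

text \<open>In the middle of a sweep the cells left of the head carry the new tracks and the others
  still the old ones, which are the only ones that \<open>exec\<close> consults.\<close>

lemma sim_forward:
  assumes "i \<le> n" "good K \<sigma>" "{b, b + 1} \<inter> {acc_st M, rej_st M} = {}"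
    and d: "\<And>q a. q \<in> {b, b + 1} \<Longrightarrow> delta M q a = sweep g x h b kt kf q a"
    and \<sigma>': "\<sigma>' = snd (exec w (Sw g x h) \<sigma>)"
  shows "run M i (b, [], cells \<sigma> @ z) =
    (if st g w \<sigma> i then b + 1 else b, rev (take i (cells \<sigma>')), drop i (cells \<sigma>) @ z)"
  using assms(1)
proof (induction i)
  case 0
  then show ?case by (simp add: run_def)
next
  case (Suc i)
  let ?q = "if st g w \<sigma> i then b + 1 else b"
  let ?X = "marks \<sigma> i"
  have i: "i < n" using Suc.prems by simp
  have dr: "drop i (cells \<sigma>) = enc_cell (w ! i) ?X # drop (Suc i) (cells \<sigma>)"
    using i by (metis Cons_nth_drop_Suc length_cells nth_cells)
  have nz: "enc_cell (w ! i) ?X \<noteq> 0" using w_nth[OF i] by (simp add: enc_cell_def)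
  have m': "marks \<sigma>' i = (if h (st g w \<sigma> i) (w ! i) ?X then insert x ?X else ?X - {x})"
    using i by (auto simp: marks_def \<sigma>')
  have tk: "rev (take (Suc i) (cells \<sigma>')) = enc_cell (w ! i) (marks \<sigma>' i) # rev (take i (cells \<sigma>'))"
    using i by (simp add: take_Suc_conv_app_nth nth_cells)
  have dl: "delta M ?q (enc_cell (w ! i) ?X) =
     (if st g w \<sigma> (Suc i) then b + 1 else b, enc_cell (w ! i) (marks \<sigma>' i), Rt)"
    using nz w_nth[OF i] finite_marks[OF assms(2)]
    by (simp add: d sweep_def Let_def enc_cell_mod enc_cell_div m')
  have "?q \<noteq> acc_st M" "?q \<noteq> rej_st M" using assms(3) by auto
  then have "step M (?q, rev (take i (cells \<sigma>')), drop i (cells \<sigma>) @ z) =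
     (if st g w \<sigma> (Suc i) then b + 1 else b, rev (take (Suc i) (cells \<sigma>')), drop (Suc i) (cells \<sigma>) @ z)"
    unfolding tk unfolding dr using dl by simp
  moreover have "run M (Suc i) (b, [], cells \<sigma> @ z) = step M (run M i (b, [], cells \<sigma> @ z))"
    by (simp add: run_def)
  ultimately show ?case using Suc by simp
qed

text \<open>The two forms of \<open>z\<close> arise because the first sweep runs off the written
  tape and leaves a blank behind, which all later sweeps find there.\<close>

lemma sim_sweep:
  assumes "good K \<sigma>" "0 < x" "x < K" "{b..<b + 4} \<inter> {acc_st M, rej_st M} = {}"
    and d: "\<And>q a. q \<in> {b..<b + 4} \<Longrightarrow> delta M q a = sweep g x h b kt kf q a"
    and "exec w (Sw g x h) \<sigma> = (r, \<sigma>')" "z = [] \<or> z = [0]"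
  shows "reach M (b, [], cells \<sigma> @ z) (2 * n + 1) (if r then kt else kf, [], cells \<sigma>' @ [0])"
proof -
  have r: "r = st g w \<sigma> n" and \<sigma>': "\<sigma>' = snd (exec w (Sw g x h) \<sigma>)" using assms(6) by auto
  have g': "good K \<sigma>'" unfolding \<sigma>' using assms(1,2,3) by (intro good_exec) auto
  have d': "delta M q a = sweep g x h b kt kf q a" if "q \<in> {b, b + 1}" for q a
    using that by (intro d) auto
  have 1: "run M n (b, [], cells \<sigma> @ z) = (if r then b + 1 else b, rev (cells \<sigma>'), z)"
    using sim_forward[OF _ assms(1) _ _ \<sigma>', of n b M kt kf z, OF _ _ d'] assms(4) r by (cases "st g w \<sigma> n") auto
  obtain n' where n': "n = Suc n'" using n_pos by (cases n) auto
  have tk: "rev (cells \<sigma>') = cells \<sigma>' ! n' # rev (take n' (cells \<sigma>'))"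
    using n' take_Suc_conv_app_nth[of n' "cells \<sigma>'"] by simp
  have dr: "drop n' (cells \<sigma>') = [cells \<sigma>' ! n']"
    using n' Cons_nth_drop_Suc[of n' "cells \<sigma>'"] by simp
  have s: "step M (if r then b + 1 else b, rev (cells \<sigma>'), z) =
    (if r then b + 3 else b + 2, rev (take n' (cells \<sigma>')), drop n' (cells \<sigma>') @ [0])"
    unfolding tk dr using assms(4,7) d[of b 0] d[of "b + 1" 0] by (auto simp: sweep_def Let_def)
  have 2: "run M (n' + 1) (if r then b + 3 else b + 2, rev (take n' (cells \<sigma>')), drop n' (cells \<sigma>') @ [0])
     = (if r then kt else kf, [], cells \<sigma>' @ [0])"
    using assms(4) d n' g' by (intro sim_return[where K = K]) (auto simp: sweep_def Let_def)
  have "run M (n + 1 + (n' + 1)) (b, [], cells \<sigma> @ z) = (if r then kt else kf, [], cells \<sigma>' @ [0])"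
    using 1 2 s unfolding run_add by (simp add: run_def)
  moreover have "n + 1 + (n' + 1) \<le> 2 * n + 1" using n' by simp
  ultimately show ?thesis unfolding reach_def by blast
qed

lemma exec_init: "exec w (init_sw x) \<sigma> = (True, \<sigma>(x := {0}))"
proof -
  have "st (\<lambda>_ _ _. True) w \<sigma> i = (i > 0)" for i by (cases i) auto
  moreover have "{i. i < n \<and> \<not> 0 < i} = {0}" using n_pos by auto
  ultimately show ?thesis using n_pos by simp
qed

text \<open>The state on arrival says whether the previous cell is marked; as final answer it says
  that the mark was on the last cell and is now lost.\<close>

lemma exec_shift:
  assumes "\<sigma> x = {p}" "p < n"
  shows "exec w (shift_sw x) \<sigma> = (Suc p = n, \<sigma>(x := if Suc p < n then {Suc p} else {}))"
proof -
  have "st (\<lambda>_ _ X. x \<in> X) w \<sigma> i = (i = Suc p)" for i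
    using assms by (cases i) (auto simp: marks_def)
  moreover have "{i. i < n \<and> i = Suc p} = (if Suc p < n then {Suc p} else {})" by auto
  moreover have "n = Suc p \<longleftrightarrow> Suc p = n" by auto
  ultimately show ?thesis by simp
qed

lemma sim:
  assumes "good K \<sigma>" "writes P \<subseteq> {0<..<K}" "wf_prog P" "{b..<b + psize P} \<inter> {acc_st M, rej_st M} = {}"
    and "\<And>q a. q \<in> {b..<b + psize P} \<Longrightarrow> delta M q a = compile P b kt kf q a"
    and "exec w P \<sigma> = (r, \<sigma>')" "z = [] \<or> z = [0]"
  shows "reach M (b, [], cells \<sigma> @ z) (cost n P) (if r then kt else kf, [], cells \<sigma>' @ [0])"
  using assms
proof (induction P arbitrary: b kt kf \<sigma> r \<sigma>' z)
  case (Sw g x h)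
  then show ?case using sim_sweep[of K \<sigma> x b M g h kt kf r \<sigma>' z] by auto
next
  case (Cond P A B)
  obtain r1 \<sigma>1 where e1: "exec w P \<sigma> = (r1, \<sigma>1)" by fastforce
  have e2: "exec w (if r1 then A else B) \<sigma>1 = (r, \<sigma>')" using Cond.prems(6) e1 by (cases r1) simp_all
  have g1: "good K \<sigma>1" using good_exec[of P K \<sigma>] Cond.prems e1 by simp
  have 1: "reach M (b, [], cells \<sigma> @ z) (cost n P)
     (if r1 then b + psize P else b + psize P + psize A, [], cells \<sigma>1 @ [0])"
    using Cond.prems by (intro Cond.IH(1) e1) auto
  show ?case
  proof (cases r1)
    case True
    have "reach M (b + psize P, [], cells \<sigma>1 @ [0]) (cost n A) (if r then kt else kf, [], cells \<sigma>' @ [0])"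
      using Cond.prems e2 True g1 by (intro Cond.IH(2)) auto
    from reach_trans[OF 1[unfolded if_P[OF True]] this] show ?thesis by (rule reach_mono) simp
  next
    case False
    have "reach M (b + psize P + psize A, [], cells \<sigma>1 @ [0]) (cost n B) (if r then kt else kf, [], cells \<sigma>' @ [0])"
      using Cond.prems e2 False g1 by (intro Cond.IH(3)) auto
    moreover have "reach M (b, [], cells \<sigma> @ z) (cost n P) (b + psize P + psize A, [], cells \<sigma>1 @ [0])"
      using 1 False by simp
    ultimately have "reach M (b, [], cells \<sigma> @ z) (cost n P + cost n B) (if r then kt else kf, [], cells \<sigma>' @ [0])"
      by (rule reach_trans[rotated])
    then show ?thesis by (rule reach_mono) simp
  qed
next
  case (Any x P)
  have x: "0 < x" "x < K" "x \<notin> writes P" using Any.prems by auto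
  have body: "reach M (b + 8, [], cells \<sigma> @ [0]) (cost n P) (if r1 then kt else b + 4, [], cells \<sigma>1 @ [0])"
    if "good K \<sigma>" "exec w P \<sigma> = (r1, \<sigma>1)" for \<sigma> r1 \<sigma>1
    using Any.prems that by (intro Any.IH) auto
  \<comment> \<open>Induction on the number \<open>m\<close> of positions after \<open>p\<close>; a
    round is entered with the pointer already on \<open>p\<close> and consists of the body and one
    shift.\<close>
  have loop: "reach M (b + 8, [], cells (\<sigma>(x := {p})) @ [0]) (Suc m * (cost n P + (2 * n + 1)))
      (if r then kt else kf, [], cells \<sigma>' @ [0])"
    if "good K \<sigma>" "p < n" "n - p = Suc m" "iter x (exec w P) [p..<n] \<sigma> = (r, \<sigma>')" for p m \<sigma>
    using that
  proof (induction m arbitrary: p \<sigma>)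
    case (0 p \<sigma>)
    obtain r1 \<sigma>1 where e1: "exec w P (\<sigma>(x := {p})) = (r1, \<sigma>1)" by fastforce
    have gp: "good K (\<sigma>(x := {p}))" using 0 x by (intro good_upd) auto
    have 1: "reach M (b + 8, [], cells (\<sigma>(x := {p})) @ [0]) (cost n P) (if r1 then kt else b + 4, [], cells \<sigma>1 @ [0])"
      using body[OF gp e1] .
    have g1: "good K \<sigma>1" using good_exec[of P K "\<sigma>(x := {p})"] Any.prems e1 gp by simp
    have \<sigma>1x: "\<sigma>1 x = {p}" using exec_unchanged[of x P w "\<sigma>(x := {p})"] x e1 by simp
    have up: "[p..<n] = [p]" using 0 upt_conv_Cons[of p n] by simp
    show ?case
    proof (cases r1)
      case True
      then have "r" "\<sigma>' = \<sigma>1" using 0(4) up e1 by simp_all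
      then show ?thesis using 1 True by (simp add: reach_mono del: fun_upd_apply)
    next
      case False
      \<comment> \<open>Here \<open>p\<close> is the last position, so the shift loses the mark and
        takes the failure exit of the loop.\<close>
      have "exec w (shift_sw x) \<sigma>1 = (True, \<sigma>1(x := {}))"
        using exec_shift[of \<sigma>1 x p] \<sigma>1x 0 by simp
      then have "reach M (b + 4, [], cells \<sigma>1 @ [0]) (2 * n + 1) (if True then kf else b + 8, [], cells (\<sigma>1(x := {})) @ [0])"
        using Any.prems g1 x by (intro sim_sweep) auto
      moreover have "reach M (b + 8, [], cells (\<sigma>(x := {p})) @ [0]) (cost n P) (b + 4, [], cells \<sigma>1 @ [0])"
        using 1 False by simp
      ultimately have "reach M (b + 8, [], cells (\<sigma>(x := {p})) @ [0]) (cost n P + (2 * n + 1)) (kf, [], cells (\<sigma>1(x := {})) @ [0])"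
        unfolding if_True by (rule reach_trans[rotated])
      moreover have "\<not> r" "\<sigma>' = \<sigma>1(x := {})" using 0(4) up e1 False by simp_all
      ultimately show ?thesis by (simp del: fun_upd_apply)
    qed
  next
    case (Suc m p \<sigma>)
    obtain r1 \<sigma>1 where e1: "exec w P (\<sigma>(x := {p})) = (r1, \<sigma>1)" by fastforce
    have gp: "good K (\<sigma>(x := {p}))" using Suc x by (intro good_upd) auto
    have 1: "reach M (b + 8, [], cells (\<sigma>(x := {p})) @ [0]) (cost n P) (if r1 then kt else b + 4, [], cells \<sigma>1 @ [0])"
      using body[OF gp e1] .
    have g1: "good K \<sigma>1" using good_exec[of P K "\<sigma>(x := {p})"] Any.prems e1 gp by simp
    have \<sigma>1x: "\<sigma>1 x = {p}" using exec_unchanged[of x P w "\<sigma>(x := {p})"] x e1 by simp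
    have up: "[p..<n] = p # [Suc p..<n]" using Suc.prems by (intro upt_conv_Cons) simp
    show ?case
    proof (cases r1)
      case True
      then have "r" "\<sigma>' = \<sigma>1" using Suc.prems(4) up e1 by simp_all
      then show ?thesis using 1 True by (simp add: reach_mono del: fun_upd_apply)
    next
      case False
      have p': "Suc p < n" using Suc.prems by simp
      have "exec w (shift_sw x) \<sigma>1 = (False, \<sigma>1(x := {Suc p}))"
        using exec_shift[of \<sigma>1 x p] \<sigma>1x p' by simp
      then have "reach M (b + 4, [], cells \<sigma>1 @ [0]) (2 * n + 1) (if False then kf else b + 8, [], cells (\<sigma>1(x := {Suc p})) @ [0])"
        using Any.prems g1 x by (intro sim_sweep) auto
      moreover have "reach M (b + 8, [], cells (\<sigma>(x := {p})) @ [0]) (cost n P) (b + 4, [], cells \<sigma>1 @ [0])"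
        using 1 False by simp
      ultimately have "reach M (b + 8, [], cells (\<sigma>(x := {p})) @ [0]) (cost n P + (2 * n + 1)) (b + 8, [], cells (\<sigma>1(x := {Suc p})) @ [0])"
        unfolding if_False by (rule reach_trans[rotated])
      moreover have "reach M (b + 8, [], cells (\<sigma>1(x := {Suc p})) @ [0]) (Suc m * (cost n P + (2 * n + 1)))
          (if r then kt else kf, [], cells \<sigma>' @ [0])"
        using Suc.prems g1 p' up e1 False by (intro Suc.IH) auto
      ultimately have "reach M (b + 8, [], cells (\<sigma>(x := {p})) @ [0])
          (cost n P + (2 * n + 1) + Suc m * (cost n P + (2 * n + 1))) (if r then kt else kf, [], cells \<sigma>' @ [0])"
        by (rule reach_trans)
      then show ?thesis by (rule reach_mono) simp
    qed
  qed
  have "reach M (b, [], cells \<sigma> @ z) (2 * n + 1) (if True then b + 8 else b + 8, [], cells (\<sigma>(x := {0})) @ [0])"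
    using Any.prems x exec_init[of x \<sigma>] by (intro sim_sweep) auto
  moreover have "reach M (b + 8, [], cells (\<sigma>(x := {0})) @ [0]) (Suc (n - 1) * (cost n P + (2 * n + 1)))
      (if r then kt else kf, [], cells \<sigma>' @ [0])"
    using Any.prems n_pos by (intro loop) auto
  ultimately have "reach M (b, [], cells \<sigma> @ z) (2 * n + 1 + Suc (n - 1) * (cost n P + (2 * n + 1)))
      (if r then kt else kf, [], cells \<sigma>' @ [0])"
    unfolding if_cancel by (rule reach_trans)
  moreover have "Suc (n - 1) = n" using n_pos by simp
  ultimately show ?case by (simp only: cost.simps)
qed

end

section \<open>The machine of a program\<close>

definition init_tracks :: tracks where
  "init_tracks = (\<lambda>j. if j = 0 then {0} else {})"

text \<open>States 1 and 2 are the verdicts, state 0 marks the origin, and the program starts at 3.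
  The empty word has no cell for the origin mark, so its verdict is wired in as
  \<open>e\<close>.\<close>

definition machine :: "prog \<Rightarrow> nat \<Rightarrow> bool \<Rightarrow> tm" where
  "machine P K e = \<lparr>nstates = 3 + psize P, nsyms = 8 * 2 ^ K,
     delta = (\<lambda>q a. if q = 0 then (if a = 0 then (if e then 1 else 2, 0, Stay)
                                   else (3, enc_cell (a mod 8) {0}, Stay))
                    else if q < 3 then (q, a, Stay) else compile P 3 1 2 q a),
     acc_st = 1, rej_st = 2\<rparr>"

lemma wf_machine:
  assumes "writes P \<subseteq> {0<..<K}" "0 < K"
  shows "wf_tm (machine P K e)"
proof -
  have w: "writes P \<subseteq> {..<K}" using assms(1) by auto
  have s: "enc_cell (a mod 8) {0} < 8 * 2 ^ K" for a
    using assms(2) by (intro enc_cell_bound) auto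
  have "(5::nat) \<le> 8 * 2 ^ K" using one_le_power[of "2::nat" K] by linarith
  then show ?thesis
    using psize_pos[of P] s compile_symbol_bound[OF _ w] compile_state_bound[of 3 P "3 + psize P" 1 2]
    by (auto simp: wf_tm_def machine_def)
qed

lemma run_halted: "fst c = acc_st M \<or> fst c = rej_st M \<Longrightarrow> run M t c = c"
  unfolding run_def by (induction t) (cases c; auto)+

text \<open>Halting configurations are fixed by \<open>step\<close>, so a run may be prolonged to
  the exact time that the complexity bound prescribes.\<close>

lemma reach_halted:
  assumes "reach M c t c'" "fst c' = acc_st M \<or> fst c' = rej_st M" "t \<le> t'"
  shows "run M t' c = c'"
proof -
  obtain T where T: "T \<le> t" "run M T c = c'" using assms(1) unfolding reach_def by blast
  have "run M (T + (t' - T)) c = run M (t' - T) c'" unfolding run_add T ..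
  then show ?thesis using run_halted[OF assms(2)] T(1) assms(3) by simp
qed

lemma (in word) machine_correct:
  assumes "writes P \<subseteq> {0<..<K}" "0 < K" "wf_prog P" "1 + cost n P \<le> t"
  shows "fst (run (machine P K e) t (0, [], w)) = (if fst (exec w P init_tracks) then 1 else 2)"
proof -
  let ?M = "machine P K e"
  have g: "good K init_tracks" using n_pos assms(2) by (auto simp: good_def init_tracks_def)
  obtain a r where w: "w = a # r" using w_ne by (cases w) auto
  have a: "0 < a" "a < 8" using w_sym w by auto
  have m: "marks init_tracks i = (if i = 0 then {0} else {})" for i
    by (auto simp: marks_def init_tracks_def)
  \<comment> \<open>Only the first cell differs from the input, because \<open>enc_cell s {}\<close>
    is \<open>s\<close>.\<close>
  have c: "cells init_tracks = enc_cell a {0} # r"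
  proof (rule nth_equalityI)
    show "length (cells init_tracks) = length (enc_cell a {0} # r)"
      unfolding length_cells by (simp add: w)
    fix i assume "i < length (cells init_tracks)"
    then have "cells init_tracks ! i = enc_cell (w ! i) (if i = 0 then {0} else {})"
      by (simp add: nth_cells m)
    then show "cells init_tracks ! i = (enc_cell a {0} # r) ! i"
      by (cases i) (simp_all add: w enc_cell_def)
  qed
  have "run ?M 1 (0, [], w) = (3, [], cells init_tracks @ [])"
    using a w c by (simp add: run_def machine_def)
  then have 1: "reach ?M (0, [], w) 1 (3, [], cells init_tracks @ [])" unfolding reach_def by blast
  obtain b \<sigma>' where e: "exec w P init_tracks = (b, \<sigma>')" by fastforce
  have "reach ?M (3, [], cells init_tracks @ []) (cost n P) (if b then 1 else 2, [], cells \<sigma>' @ [0])"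
    using g assms e by (intro sim[where K = K]) (auto simp: machine_def)
  with 1 have "reach ?M (0, [], w) (1 + cost n P) (if b then 1 else 2, [], cells \<sigma>' @ [0])"
    by (rule reach_trans)
  from reach_halted[OF this _ assms(4)] show ?thesis using e by (simp add: machine_def)
qed

section \<open>First-order formulas over the positions of a word\<close>

text \<open>\<open>Nd\<close> and \<open>EqS\<close> are primitive because they skip or compare
  strings of unbounded length; \<open>Dead\<close> is the only atom whose truth changes during the
  deletion.\<close>

datatype fm =
    FF | Sym nat "nat set" | Succ nat nat | Nd nat nat | Dead nat | EqS nat nat
  | Neg fm | And fm fm | Exists nat fm

definition strg :: "nat list \<Rightarrow> nat \<Rightarrow> nat list" where
  "strg w i = takeWhile (\<lambda>s. s \<le> 2) (drop i w)"

text \<open>The first position from \<open>i\<close> on that holds no bit, that is, the separator or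
  end of fact that closes the string at \<open>i\<close>.\<close>

definition nd :: "nat list \<Rightarrow> nat \<Rightarrow> nat" where
  "nd w i = i + length (strg w i)"

primrec sem :: "nat list \<Rightarrow> nat set \<Rightarrow> (nat \<Rightarrow> nat) \<Rightarrow> fm \<Rightarrow> bool" where
  "sem w D \<rho> FF = False"
| "sem w D \<rho> (Sym x S) = (w ! \<rho> x \<in> S)"
| "sem w D \<rho> (Succ x y) = (\<rho> y = Suc (\<rho> x))"
| "sem w D \<rho> (Nd x y) = (\<rho> y = nd w (\<rho> x))"
| "sem w D \<rho> (Dead x) = (\<rho> x \<in> D)"
| "sem w D \<rho> (EqS x y) = (Suc (\<rho> x) < length w \<and> Suc (\<rho> y) < length w \<and>
     strg w (Suc (\<rho> x)) = strg w (Suc (\<rho> y)))"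
| "sem w D \<rho> (Neg \<phi>) = (\<not> sem w D \<rho> \<phi>)"
| "sem w D \<rho> (And \<phi> \<psi>) = (sem w D \<rho> \<phi> \<and> sem w D \<rho> \<psi>)"
| "sem w D \<rho> (Exists x \<phi>) = (\<exists>p<length w. sem w D (\<rho>(x := p)) \<phi>)"

text \<open>The bound variable is the first one not in scope, so no loop reuses the track of an
  enclosing one.\<close>

primrec wfm :: "nat \<Rightarrow> fm \<Rightarrow> bool" where
  "wfm d FF = True"
| "wfm d (Sym x S) = (x < d)"
| "wfm d (Succ x y) = (x < d \<and> y < d)"
| "wfm d (Nd x y) = (x < d \<and> y < d)"
| "wfm d (Dead x) = (x < d)"
| "wfm d (EqS x y) = (x < d \<and> y < d)"
| "wfm d (Neg \<phi>) = wfm d \<phi>"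
| "wfm d (And \<phi> \<psi>) = (wfm d \<phi> \<and> wfm d \<psi>)"
| "wfm d (Exists x \<phi>) = (x = d \<and> wfm (Suc x) \<phi>)"

text \<open>Every sweep has to write some track, so a pure test clears the scratch track 2.\<close>

definition tst :: "(nat \<Rightarrow> nat set \<Rightarrow> bool) \<Rightarrow> prog" where
  "tst f = Sw (\<lambda>q s X. q \<or> f s X) 2 (\<lambda>_ _ _. False)"

definition seqp :: "prog \<Rightarrow> prog \<Rightarrow> prog" where
  "seqp P R = Cond P R R"

definition copy_track :: "nat \<Rightarrow> nat \<Rightarrow> prog" where
  "copy_track x y = Sw (\<lambda>_ _ _. False) x (\<lambda>_ _ X. y \<in> X)"

abbreviation FFp :: prog where "FFp \<equiv> tst (\<lambda>_ _. False)"
abbreviation TTp :: prog where "TTp \<equiv> tst (\<lambda>_ _. True)"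
abbreviation symt :: "nat \<Rightarrow> nat set \<Rightarrow> prog" where "symt x S \<equiv> tst (\<lambda>s X. x \<in> X \<and> s \<in> S)"

definition same_bit :: prog where
  "same_bit = Cond (symt 3 {1}) (symt 4 {1}) (Cond (symt 3 {2}) (symt 4 {2}) FFp)"

definition both_end :: prog where
  "both_end = Cond (symt 3 {2<..}) (symt 4 {2<..}) FFp"

text \<open>Success of the body stops the loop: it is reported as soon as the two pointers no longer
  see the same bit. Otherwise both advance and the round fails, which means going on.\<close>

definition eq_body :: prog where
  "eq_body = Cond same_bit (seqp (shift_sw 3) (seqp (shift_sw 4) FFp)) TTp"

text \<open>After the parallel walk the strings are equal exactly if both pointers have arrived
  behind their string.\<close>

definition eq_prog :: "nat \<Rightarrow> nat \<Rightarrow> prog" where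
  "eq_prog x y = seqp (copy_track 3 x) (seqp (shift_sw 3) (seqp (copy_track 4 y) (seqp (shift_sw 4)
     (seqp (Any 5 eq_body) both_end))))"

text \<open>Track 0 marks the origin, track 1 the dead positions, tracks 2 to 5 are scratch, and
  track \<open>x + 6\<close> holds the pointer variable \<open>x\<close>.\<close>

primrec tr :: "fm \<Rightarrow> prog" where
  "tr FF = FFp"
| "tr (Sym x S) = symt (x + 6) S"
| "tr (Succ x y) = seqp (Sw (\<lambda>_ _ X. x + 6 \<in> X) 2 (\<lambda>q _ _. q)) (tst (\<lambda>_ X. 2 \<in> X \<and> y + 6 \<in> X))"
| "tr (Nd x y) = seqp (Sw (\<lambda>q s X. (q \<or> x + 6 \<in> X) \<and> s \<le> 2) 2 (\<lambda>q s X. (q \<or> x + 6 \<in> X) \<and> \<not> s \<le> 2))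
     (tst (\<lambda>_ X. 2 \<in> X \<and> y + 6 \<in> X))"
| "tr (Dead x) = tst (\<lambda>_ X. 1 \<in> X \<and> x + 6 \<in> X)"
| "tr (EqS x y) = eq_prog (x + 6) (y + 6)"
| "tr (Neg \<phi>) = Cond (tr \<phi>) FFp TTp"
| "tr (And \<phi> \<psi>) = Cond (tr \<phi>) (tr \<psi>) FFp"
| "tr (Exists x \<phi>) = Any (x + 6) (tr \<phi>)"

section \<open>Correctness of the translation from formulas to programs\<close>

lemma writes_tst[simp]: "writes (tst f) = {2}"
  by (simp add: tst_def)

lemma writes_seqp[simp]: "writes (seqp P R) = writes P \<union> writes R"
  by (auto simp: seqp_def)

lemma wf_tst[simp]: "wf_prog (tst f)"
  by (simp add: tst_def)

lemma wf_seqp[simp]: "wf_prog (seqp P R) \<longleftrightarrow> wf_prog P \<and> wf_prog R"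
  by (auto simp: seqp_def)

text \<open>Neither the dead positions on track 1 nor the pointers in scope are touched, so
  subformulas can be evaluated one after the other.\<close>

lemma writes_tr: "wfm d \<phi> \<Longrightarrow> writes (tr \<phi>) \<subseteq> {2..5} \<union> {d + 6..}"
proof (induction \<phi> arbitrary: d)
  case (EqS x y)
  then show ?case
    by (auto simp: eq_prog_def eq_body_def same_bit_def both_end_def copy_track_def)
next
  case (Exists x \<phi>)
  then show ?case by fastforce
qed auto

lemma wf_tr: "wfm d \<phi> \<Longrightarrow> wf_prog (tr \<phi>)"
proof (induction \<phi> arbitrary: d)
  case (EqS x y)
  then show ?case
    by (auto simp: eq_prog_def eq_body_def same_bit_def both_end_def copy_track_def)
next
  case (Exists x \<phi>)
  then show ?case using writes_tr[of "Suc x" \<phi>] by fastforce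
qed auto

lemma exec_seqp: "exec w (seqp P R) \<sigma> = exec w R (snd (exec w P \<sigma>))"
  by (simp add: seqp_def split: prod.splits)

lemma exec_Cond: "exec w (Cond P R S) \<sigma> =
    (if fst (exec w P \<sigma>) then exec w R (snd (exec w P \<sigma>)) else exec w S (snd (exec w P \<sigma>)))"
  by (simp split: prod.splits)

lemma exec_tst: "exec w (tst f) \<sigma> = (\<exists>i<length w. f (w ! i) (marks \<sigma> i), \<sigma>(2 := {}))"
proof -
  have "st (\<lambda>q s X. q \<or> f s X) w \<sigma> k \<longleftrightarrow> (\<exists>i<k. f (w ! i) (marks \<sigma> i))" for k
    by (induction k) (auto simp: less_Suc_eq)
  then show ?thesis by (simp add: tst_def)
qed

lemma exec_symt:
  assumes "\<sigma> x = {i}" "i < length w"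
  shows "exec w (symt x S) \<sigma> = (w ! i \<in> S, \<sigma>(2 := {}))"
  using assms by (auto simp: exec_tst marks_def)

text \<open>The final 4 gives every bit a right neighbour, so every string ends inside the
  word.\<close>

locale dword =
  fixes w :: "nat list"
  assumes w_ne: "w \<noteq> []" and w_sym: "s \<in> set w \<Longrightarrow> s \<in> {1, 2, 3, 4}" and w_last: "last w = 4"

sublocale dword \<subseteq> word
  using w_ne w_sym by unfold_locales fastforce+

context dword
begin

lemma nth_sym: "i < n \<Longrightarrow> w ! i \<in> {1, 2, 3, 4}"
  using w_sym nth_mem by blast

lemma last_not_bit: "\<not> w ! (n - 1) \<le> 2"
  using w_last w_ne by (simp add: last_conv_nth)

lemma bit_next: "i < n \<Longrightarrow> w ! i \<le> 2 \<Longrightarrow> Suc i < n"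
proof (rule ccontr)
  assume "i < n" "w ! i \<le> 2" "\<not> Suc i < n"
  then have "n - 1 = i" by simp
  then show False using last_not_bit \<open>w ! i \<le> 2\<close> by simp
qed

lemma strg_step: "i < n \<Longrightarrow> strg w i = (if w ! i \<le> 2 then w ! i # strg w (Suc i) else [])"
  unfolding strg_def by (simp add: Cons_nth_drop_Suc[symmetric])

lemma nd_step: "i < n \<Longrightarrow> nd w i = (if w ! i \<le> 2 then nd w (Suc i) else i)"
  by (simp add: nd_def strg_step)

lemma nd_props:
  assumes "p < n"
  shows "nd w p < n \<and> \<not> w ! nd w p \<le> 2 \<and> (\<forall>j. p \<le> j \<and> j < nd w p \<longrightarrow> w ! j \<le> 2)"
  using assms
proof (induction "n - p" arbitrary: p)
  case (Suc k)
  show ?case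
  proof (cases "w ! p \<le> 2")
    case True
    have "Suc p < n" using bit_next Suc.prems True by simp
    then have "nd w (Suc p) < n \<and> \<not> w ! nd w (Suc p) \<le> 2 \<and> (\<forall>j. Suc p \<le> j \<and> j < nd w (Suc p) \<longrightarrow> w ! j \<le> 2)"
      using Suc.hyps by (intro Suc.hyps(1)) auto
    then show ?thesis using True nd_step[OF Suc.prems] by (metis Suc_leI le_neq_implies_less)
  next
    case False
    then show ?thesis using nd_step[OF Suc.prems] Suc.prems by simp
  qed
qed simp

text \<open>This is the condition that the sweep for \<open>Nd\<close> recognizes cell by
  cell.\<close>

lemma nd_iff:
  assumes "p < n"
  shows "p \<le> i \<and> (\<forall>j. p \<le> j \<and> j < i \<longrightarrow> w ! j \<le> 2) \<and> \<not> w ! i \<le> 2 \<longleftrightarrow> i = nd w p"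
proof -
  have "p \<le> nd w p" by (simp add: nd_def)
  then show ?thesis using nd_props[OF assms] by (metis linorder_neqE_nat)
qed

lemma exec_both_end:
  "fst (exec w both_end \<sigma>) \<longleftrightarrow> (\<exists>i<n. i \<in> \<sigma> 3 \<and> 2 < w ! i) \<and> (\<exists>i<n. i \<in> \<sigma> 4 \<and> 2 < w ! i)"
proof -
  have "marks (\<sigma>(2 := {})) i = marks \<sigma> i - {2}" for i by (auto simp: marks_def)
  then show ?thesis unfolding both_end_def exec_Cond exec_tst fst_conv snd_conv
    by (simp add: marks_def)
qed

text \<open>Each failing round strips a common first bit from both strings. As \<open>ps\<close> is
  longer than the first string, the loop is left by a mismatch or an end, never by running out of
  rounds.\<close>

lemma eq_loop:
  assumes "\<sigma> 3 = {i}" "\<sigma> 4 = {j}" "i < n" "j < n" "length (strg w i) < length ps"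
  shows "fst (exec w both_end (snd (iter 5 (exec w eq_body) ps \<sigma>))) \<longleftrightarrow> strg w i = strg w j"
  using assms
proof (induction ps arbitrary: \<sigma> i j)
  case (Cons p ps)
  let ?s = "\<sigma>(5 := {p})"
  have sb: "exec w same_bit ?s = (w ! i \<le> 2 \<and> w ! i = w ! j, ?s(2 := {}))"
  proof -
    have 1: "exec w (symt 3 S) ?s = (w ! i \<in> S, ?s(2 := {}))"
      "exec w (symt 3 S) (?s(2 := {})) = (w ! i \<in> S, ?s(2 := {}))"
      "exec w (symt 4 S) (?s(2 := {})) = (w ! j \<in> S, ?s(2 := {}))"
      "exec w FFp (?s(2 := {})) = (False, ?s(2 := {}))" for S
      using Cons.prems exec_symt[of ?s 3 i w S] exec_symt[of "?s(2 := {})" 3 i w S]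
        exec_symt[of "?s(2 := {})" 4 j w S] by (simp_all add: exec_tst)
    have "w ! i \<in> {1, 2, 3, 4}" "w ! j \<in> {1, 2, 3, 4}" using nth_sym Cons.prems by auto
    then show ?thesis unfolding same_bit_def exec_Cond 1 fst_conv snd_conv by auto
  qed
  show ?case
  proof (cases "w ! i \<le> 2 \<and> w ! i = w ! j")
    case True
    have s: "Suc i < n" "Suc j < n" using True bit_next Cons.prems by auto
    let ?t = "?s(2 := {}, 3 := {Suc i}, 4 := {Suc j}, 2 := {})"
    have "exec w eq_body ?s = (False, ?t)"
      using True Cons.prems s
      by (simp add: eq_body_def exec_Cond sb exec_seqp exec_shift exec_tst del: exec.simps)
    then have "iter 5 (exec w eq_body) (p # ps) \<sigma> = iter 5 (exec w eq_body) ps ?t" by simp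
    moreover have "fst (exec w both_end (snd (iter 5 (exec w eq_body) ps ?t))) \<longleftrightarrow> strg w (Suc i) = strg w (Suc j)"
      using Cons.prems s True strg_step[of i] by (intro Cons.IH) auto
    ultimately show ?thesis using True Cons.prems strg_step[of i] strg_step[of j] by simp
  next
    case False
    have "exec w eq_body ?s = (True, ?s(2 := {}))"
      using False n_pos by (auto simp: eq_body_def exec_Cond sb exec_tst simp del: exec.simps)
    then have e: "snd (iter 5 (exec w eq_body) (p # ps) \<sigma>) = ?s(2 := {})" by simp
    have b: "fst (exec w both_end (?s(2 := {}))) \<longleftrightarrow> 2 < w ! i \<and> 2 < w ! j"
      using Cons.prems by (simp add: exec_both_end)
    \<comment> \<open>Only two non-bits make the strings equal: two bits differ here, and a bit
      against a non-bit means that just one string has ended.\<close>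
    show ?thesis unfolding e b strg_step[OF Cons.prems(3)] strg_step[OF Cons.prems(4)]
      using False by (cases "w ! i \<le> 2"; cases "w ! j \<le> 2") simp_all
  qed
qed simp

text \<open>A pointer on the last cell is lost by the initial shift, and the comparison then fails;
  this accounts for the two bounds in the semantics of \<open>EqS\<close>.\<close>

lemma eq_loop_empty:
  assumes "\<sigma> 3 = {} \<or> \<sigma> 4 = {}" "ps \<noteq> []"
  shows "\<not> fst (exec w both_end (snd (iter 5 (exec w eq_body) ps \<sigma>)))"
proof -
  obtain p qs where ps: "ps = p # qs" using assms(2) by (cases ps) auto
  let ?s = "\<sigma>(5 := {p})"
  have "\<not> fst (exec w same_bit ?s)" "snd (exec w same_bit ?s) = ?s(2 := {})"
    using assms by (auto simp: same_bit_def exec_Cond exec_tst marks_def simp del: exec.simps)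
  then have "exec w eq_body ?s = (True, ?s(2 := {}))"
    using n_pos by (auto simp: eq_body_def exec_Cond exec_tst simp del: exec.simps)
  then have e: "snd (iter 5 (exec w eq_body) ps \<sigma>) = ?s(2 := {})" by (simp add: ps)
  show ?thesis unfolding e
    using assms by (auto simp: exec_both_end)
qed

lemma exec_copy: "\<sigma> y = {i} \<Longrightarrow> i < n \<Longrightarrow> exec w (copy_track x y) \<sigma> = (False, \<sigma>(x := {i}))"
proof -
  assume a: "\<sigma> y = {i}" "i < n"
  have "st (\<lambda>_ _ _. False) w \<sigma> k = False" for k by (cases k) auto
  moreover have "{k. k < n \<and> k = i} = {i}" using a(2) by auto
  ultimately show ?thesis using a(1) by (simp add: copy_track_def marks_def)
qed

lemma exec_eq_prog:
  assumes "\<sigma> x = {i}" "\<sigma> y = {j}" "i < n" "j < n" "5 < x" "5 < y"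
  shows "fst (exec w (eq_prog x y) \<sigma>) \<longleftrightarrow> Suc i < n \<and> Suc j < n \<and> strg w (Suc i) = strg w (Suc j)"
proof -
  let ?S = "\<lambda>i. if Suc i < n then {Suc i} else {}"
  let ?t = "\<sigma>(3 := {i}, 3 := ?S i, 4 := {j}, 4 := ?S j)"
  have "exec w (eq_prog x y) \<sigma> = exec w both_end (snd (iter 5 (exec w eq_body) [0..<n] ?t))"
    using assms by (simp add: eq_prog_def exec_seqp exec_copy exec_shift del: exec.simps(1,2) fun_upd_upd)
  moreover have "length (strg w (Suc i)) < length [0..<n]" if "Suc i < n"
    using nd_props[OF that] by (simp add: nd_def)
  ultimately show ?thesis
    using eq_loop[of ?t "Suc i" "Suc j" "[0..<n]"] eq_loop_empty[of ?t "[0..<n]"] n_pos w_ne by auto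
qed

definition env :: "nat \<Rightarrow> (nat \<Rightarrow> nat) \<Rightarrow> tracks \<Rightarrow> bool" where
  "env d \<rho> \<sigma> \<longleftrightarrow> (\<forall>x<d. \<sigma> (x + 6) = {\<rho> x} \<and> \<rho> x < n)"

lemma tr_preserves:
  assumes "wfm d \<phi>" "env d \<rho> \<sigma>"
  shows "env d \<rho> (snd (exec w (tr \<phi>) \<sigma>))" "snd (exec w (tr \<phi>) \<sigma>) 1 = \<sigma> 1"
proof -
  have "snd (exec w (tr \<phi>) \<sigma>) y = \<sigma> y" if "y < d + 6" "5 < y \<or> y < 2" for y
    using writes_tr[OF assms(1)] that by (intro exec_unchanged) auto
  then show "env d \<rho> (snd (exec w (tr \<phi>) \<sigma>))" "snd (exec w (tr \<phi>) \<sigma>) 1 = \<sigma> 1"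
    using assms(2) by (auto simp: env_def)
qed

text \<open>The tracks drift from round to round, so the answer of a round must depend on
  \<open>p\<close> alone as long as the invariant \<open>I\<close> holds.\<close>

lemma iter_ex:
  assumes f: "\<And>p \<sigma>. p < n \<Longrightarrow> I \<sigma> \<Longrightarrow> fst (f (\<sigma>(x := {p}))) = Q p \<and> I (snd (f (\<sigma>(x := {p}))))"
    and "I \<sigma>" "set ps \<subseteq> {..<n}"
  shows "fst (iter x f ps \<sigma>) \<longleftrightarrow> (\<exists>p\<in>set ps. Q p)"
  using assms(2,3)
proof (induction ps arbitrary: \<sigma>)
  case (Cons p ps)
  obtain r \<sigma>' where e: "f (\<sigma>(x := {p})) = (r, \<sigma>')" by fastforce
  then show ?case using f[of p \<sigma>] Cons by auto
qed simp

lemma tr_correct: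
  assumes "wfm d \<phi>" "env d \<rho> \<sigma>"
  shows "fst (exec w (tr \<phi>) \<sigma>) = sem w (\<sigma> 1) \<rho> \<phi>"
  using assms
proof (induction \<phi> arbitrary: d \<rho> \<sigma>)
  case FF
  then show ?case by (simp add: exec_tst)
next
  case (Sym x S)
  then show ?case by (simp add: env_def exec_symt)
next
  case (Succ x y)
  have x: "\<sigma> (x + 6) = {\<rho> x}" "\<sigma> (y + 6) = {\<rho> y}" "\<rho> y < n" using Succ by (auto simp: env_def)
  have "st (\<lambda>_ _ X. x + 6 \<in> X) w \<sigma> i = (i = Suc (\<rho> x))" for i
    using x by (cases i) (auto simp: marks_def)
  then show ?case using x by (auto simp: exec_seqp exec_tst marks_def)
next
  case (Nd x y)
  let ?g = "\<lambda>q s X. (q \<or> x + 6 \<in> X) \<and> s \<le> (2::nat)"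
  have x: "\<sigma> (x + 6) = {\<rho> x}" "\<sigma> (y + 6) = {\<rho> y}" "\<rho> y < n" "\<rho> x < n" using Nd by (auto simp: env_def)
  have s: "st ?g w \<sigma> i \<longleftrightarrow> \<rho> x < i \<and> (\<forall>j. \<rho> x \<le> j \<and> j < i \<longrightarrow> w ! j \<le> 2)" for i
    using x by (induction i) (auto simp: marks_def less_Suc_eq)
  \<comment> \<open>On arrival at the cell of \<open>x\<close> the scan is not yet running, hence
    the extra disjunct \<open>i = \<rho> x\<close>.\<close>
  have i: "i < n \<and> (st ?g w \<sigma> i \<or> i = \<rho> x) \<and> \<not> w ! i \<le> 2 \<longleftrightarrow> i = nd w (\<rho> x)" for i
  proof
    assume "i < n \<and> (st ?g w \<sigma> i \<or> i = \<rho> x) \<and> \<not> w ! i \<le> 2"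
    then show "i = nd w (\<rho> x)" by (intro nd_iff[THEN iffD1] x(4)) (auto simp: s)
  next
    assume "i = nd w (\<rho> x)"
    then show "i < n \<and> (st ?g w \<sigma> i \<or> i = \<rho> x) \<and> \<not> w ! i \<le> 2"
      using nd_props[OF x(4)] s[of i] by (cases "i = \<rho> x") (auto simp: nd_def)
  qed
  have "exec w (Sw ?g 2 (\<lambda>q s X. (q \<or> x + 6 \<in> X) \<and> \<not> s \<le> 2)) \<sigma> = (st ?g w \<sigma> n, \<sigma>(2 := {nd w (\<rho> x)}))"
    unfolding exec.simps using i x(1) by (simp add: marks_def)
  then show ?case using x by (auto simp: exec_seqp exec_tst marks_def simp del: exec.simps)
next
  case (Dead x)
  then show ?case by (auto simp: env_def exec_tst marks_def)
next
  case (EqS x y)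
  then show ?case by (simp add: env_def exec_eq_prog)
next
  case (Neg \<phi>)
  then show ?case using n_pos by (auto simp: exec_Cond exec_tst simp del: exec.simps)
next
  case (And \<phi> \<psi>)
  have "wfm d \<phi>" "wfm d \<psi>" using And.prems by auto
  then show ?case using And.IH(1)[of d \<rho> \<sigma>] And.IH(2)[of d \<rho> "snd (exec w (tr \<phi>) \<sigma>)"]
      tr_preserves[of d \<phi> \<rho> \<sigma>] And.prems(2)
    by (simp add: exec_Cond exec_tst del: exec.simps)
next
  case (Exists x \<phi>)
  have w: "x = d" "wfm (Suc x) \<phi>" using Exists.prems by auto
    have "fst (iter (x + 6) (exec w (tr \<phi>)) [0..<n] \<sigma>) \<longleftrightarrow> (\<exists>p\<in>set [0..<n]. sem w (\<sigma> 1) (\<rho>(x := p)) \<phi>)"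
    proof (rule iter_ex[where I = "\<lambda>\<sigma>'. env d \<rho> \<sigma>' \<and> \<sigma>' 1 = \<sigma> 1"])
      fix p \<sigma>' assume p: "p < n" and I: "env d \<rho> \<sigma>' \<and> \<sigma>' 1 = \<sigma> 1"
      have e: "env (Suc x) (\<rho>(x := p)) (\<sigma>'(x + 6 := {p}))"
        using p I w by (auto simp: env_def)
      have "env d \<rho> \<sigma>''" if "env (Suc x) (\<rho>(x := p)) \<sigma>''" for \<sigma>''
        using that w unfolding env_def by (metis fun_upd_other less_SucI nat_neq_iff)
      moreover have 1: "(\<sigma>'(x + 6 := {p})) 1 = \<sigma> 1" using I by simp
      ultimately show "fst (exec w (tr \<phi>) (\<sigma>'(x + 6 := {p}))) = sem w (\<sigma> 1) (\<rho>(x := p)) \<phi> \<and>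
          env d \<rho> (snd (exec w (tr \<phi>) (\<sigma>'(x + 6 := {p})))) \<and>
          snd (exec w (tr \<phi>) (\<sigma>'(x + 6 := {p}))) 1 = \<sigma> 1"
        using Exists.IH[OF w(2) e, unfolded 1] tr_preserves[OF w(2) e, unfolded 1] by blast
    qed (use Exists.prems in auto)
    then show ?case by auto
qed

end

section \<open>Positions in the encoding of a database\<close>

declare bin.simps[simp del]

lemma set_bin: "set (bin c) \<subseteq> {1, 2}"
proof (induction c rule: bin.induct)
  case (1 c)
  show ?case using 1 by (cases "c = 0") (auto simp: bin.simps[of c] bin.simps[of 0])
qed

lemma bin_inject: "bin c = bin d \<longleftrightarrow> c = d"
proof
  show "bin c = bin d \<Longrightarrow> c = d"
  proof (induction c arbitrary: d rule: bin.induct)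
    case (1 c)
    show ?case
    proof (cases "c = 0 \<or> d = 0")
      case True
      then show ?thesis using 1(2) by (auto simp: bin.simps split: if_splits)
    next
      case False
      then have "c mod 2 = d mod 2" "bin (c div 2) = bin (d div 2)"
        using 1(2) by (simp_all add: bin.simps[of c] bin.simps[of d])
      then have "c mod 2 = d mod 2" "c div 2 = d div 2" using 1(1) False by auto
      then show ?thesis by (metis div_mult_mod_eq)
    qed
  qed
qed simp

section \<open>Facts and arguments as positions\<close>

definition offs :: "(nat \<times> nat list) list \<Rightarrow> nat \<Rightarrow> nat" where
  "offs fs k = length (enc_db (take k fs))"

text \<open>For a fact that starts at \<open>a\<close>, the separator in front of argument
  \<open>i\<close>, found by skipping one string after another.\<close>

primrec apos :: "nat list \<Rightarrow> nat \<Rightarrow> nat \<Rightarrow> nat" where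
  "apos w a 0 = nd w a"
| "apos w a (Suc i) = nd w (Suc (apos w a i))"

abbreviation enc_args :: "nat list \<Rightarrow> nat list" where
  "enc_args cs \<equiv> concat (map (\<lambda>c. 3 # bin c) cs)"

lemma enc_db_Cons: "enc_db (f # fs) = enc_fact f @ enc_db fs"
  by (simp add: enc_db_def)

lemma enc_db_append: "enc_db (fs @ gs) = enc_db fs @ enc_db gs"
  by (simp add: enc_db_def)

lemma set_enc_args: "set (enc_args cs) \<subseteq> {1, 2, 3}"
  using set_bin by (induction cs) fastforce+

lemma set_enc_db: "set (enc_db fs) \<subseteq> {1, 2, 3, 4}"
proof (induction fs)
  case (Cons f fs)
  have "set (bin (fst f)) \<subseteq> {1, 2, 3, 4}" "set (enc_args (snd f)) \<subseteq> {1, 2, 3, 4}"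
    using set_bin[of "fst f"] set_enc_args[of "snd f"] by blast+
  then show ?case using Cons by (simp only: enc_db_Cons enc_fact_def set_append) simp
qed (simp add: enc_db_def)

lemma dword_enc_db:
  assumes "fs \<noteq> []"
  shows "dword (enc_db fs)"
proof
  show "enc_db fs \<noteq> []" using assms by (cases fs) (auto simp: enc_db_Cons enc_fact_def)
  show "s \<in> {1, 2, 3, 4}" if "s \<in> set (enc_db fs)" for s using set_enc_db that by blast
  show "last (enc_db fs) = 4"
    using assms by (cases fs rule: rev_cases) (auto simp: enc_db_def enc_fact_def)
qed

lemma length_enc_db_0: "enc_db fs = [] \<longleftrightarrow> fs = []"
  by (cases fs) (auto simp: enc_db_def enc_fact_def)

lemma drop_offs:
  assumes "k < length fs"
  shows "drop (offs fs k) (enc_db fs) = enc_fact (fs ! k) @ enc_db (drop (Suc k) fs)"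
proof -
  have "fs = take k fs @ fs ! k # drop (Suc k) fs" using assms by (rule id_take_nth_drop)
  then have "enc_db fs = enc_db (take k fs) @ enc_fact (fs ! k) @ enc_db (drop (Suc k) fs)"
    by (metis enc_db_append enc_db_Cons)
  then show ?thesis by (simp add: offs_def)
qed

lemma offs_less: "k < length fs \<Longrightarrow> offs fs k < length (enc_db fs)"
  using drop_offs[of k fs] by (metis drop_all enc_fact_def append_is_Nil_conv list.distinct(1) not_le_imp_less)

lemma drop_bits:
  assumes "drop a w = bs @ d # r" "set bs \<subseteq> {1, 2}" "2 < d"
  shows "strg w a = bs" "drop (nd w a) w = d # r" "w ! nd w a = d" "nd w a < length w"
proof -
  show s: "strg w a = bs" using assms by (auto simp: strg_def takeWhile_append)
  have "drop (nd w a) w = drop (length bs) (drop a w)" by (simp add: nd_def s add.commute)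
  then show d: "drop (nd w a) w = d # r" using assms by simp
  then show l: "nd w a < length w" by (metis drop_all list.distinct(1) not_le_imp_less)
  show "w ! nd w a = d" using d l by (metis nth_via_drop)
qed

text \<open>Describing the whole suffix of the word, not just one symbol, lets the induction skip
  one argument at a time.\<close>

lemma apos_drop:
  assumes "drop a w = bin p @ enc_args cs @ 4 # r" "i < length cs"
  shows "drop (apos w a i) w = 3 # bin (cs ! i) @ enc_args (drop (Suc i) cs) @ 4 # r"
  using assms(2)
proof (induction i)
  case 0
  then obtain c cs' where "cs = c # cs'" by (cases cs) auto
  then show ?case using drop_bits(2)[of a w "bin p" 3] assms(1) set_bin[of p] by simp
next
  case (Suc i)
  then have "drop (apos w a i) w = 3 # bin (cs ! i) @ enc_args (drop (Suc i) cs) @ 4 # r" by simp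
  then have "drop (Suc (apos w a i)) w = bin (cs ! i) @ enc_args (drop (Suc i) cs) @ 4 # r"
    by (metis drop_Suc tl_drop list.sel(3))
  moreover have "drop (Suc i) cs = cs ! Suc i # drop (Suc (Suc i)) cs"
    using Suc.prems by (simp add: Cons_nth_drop_Suc)
  ultimately show ?case
    using drop_bits(2)[of "Suc (apos w a i)" w "bin (cs ! i)" 3] set_bin[of "cs ! i"] by simp
qed

lemma fact_at_offs:
  assumes "k < length fs" "fs ! k = (p, cs)"
  defines "w \<equiv> enc_db fs" and "a \<equiv> offs fs k"
  shows "strg w a = bin p"
    and "i < length cs \<Longrightarrow> apos w a i < length w \<and> w ! apos w a i = 3 \<and>
      Suc (apos w a i) < length w \<and> strg w (Suc (apos w a i)) = bin (cs ! i)"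
proof -
  define r where "r = enc_db (drop (Suc k) fs)"
  have d: "drop a w = bin p @ enc_args cs @ 4 # r"
    using drop_offs[OF assms(1)] assms(2) by (simp add: w_def a_def r_def enc_fact_def)
  show "strg w a = bin p"
  proof (cases cs)
    case Nil
    then show ?thesis using d drop_bits(1)[of a w "bin p" 4 r] set_bin[of p] by simp
  next
    case (Cons c cs')
    then show ?thesis using d drop_bits(1)[of a w "bin p" 3] set_bin[of p] by simp
  qed
  assume "i < length cs"
  from apos_drop[OF d this] have
    e: "drop (apos w a i) w = 3 # bin (cs ! i) @ enc_args (drop (Suc i) cs) @ 4 # r" .
  have l: "apos w a i < length w" using e by (metis drop_all list.distinct(1) not_le_imp_less)
  have s: "drop (Suc (apos w a i)) w = bin (cs ! i) @ enc_args (drop (Suc i) cs) @ 4 # r"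
    using e by (metis drop_Suc tl_drop list.sel(3))
  have "Suc (apos w a i) < length w"
    using s by (metis drop_all append_is_Nil_conv list.distinct(1) not_le_imp_less)
  moreover have "strg w (Suc (apos w a i)) = bin (cs ! i)"
  proof (cases "drop (Suc i) cs")
    case Nil
    then show ?thesis using s drop_bits(1)[of _ w "bin (cs ! i)" 4 r] set_bin[of "cs ! i"] by simp
  next
    case (Cons c cs')
    then show ?thesis using s drop_bits(1)[of _ w "bin (cs ! i)" 3] set_bin[of "cs ! i"] by simp
  qed
  ultimately show "apos w a i < length w \<and> w ! apos w a i = 3 \<and>
      Suc (apos w a i) < length w \<and> strg w (Suc (apos w a i)) = bin (cs ! i)"
    using e l by (metis nth_via_drop)
qed

text \<open>Quantified variables will point to arbitrary separators, so each of them must precede a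
  numeral, whichever fact it belongs to.\<close>

definition separated :: "nat list \<Rightarrow> bool" where
  "separated u \<longleftrightarrow> (\<forall>i<length u. u ! i = 3 \<longrightarrow> (\<exists>c. strg u (Suc i) = bin c))"

lemma separated_append:
  assumes "3 \<notin> set v" "separated u"
  shows "separated (v @ u)"
  unfolding separated_def
proof (intro allI impI)
  fix i assume i: "i < length (v @ u)" "(v @ u) ! i = 3"
  then have l: "length v \<le> i" using assms(1) by (metis not_le_imp_less nth_append nth_mem)
  then have "u ! (i - length v) = 3" "i - length v < length u" using i by (auto simp: nth_append)
  then obtain c where "strg u (Suc (i - length v)) = bin c" using assms(2) unfolding separated_def by blast
  then show "\<exists>c. strg (v @ u) (Suc i) = bin c"
    using l by (auto simp: strg_def Suc_diff_le)
qed

lemma separated_arg: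
  assumes "separated (d # u)" "2 < d"
  shows "separated (3 # bin c @ d # u)"
  unfolding separated_def
proof (intro allI impI)
  have "3 \<notin> set (bin c)" using set_bin[of c] by auto
  then have s: "separated (bin c @ d # u)" using assms separated_append by blast
  fix i assume i: "i < length (3 # bin c @ d # u)" "(3 # bin c @ d # u) ! i = 3"
  show "\<exists>c'. strg (3 # bin c @ d # u) (Suc i) = bin c'"
  proof (cases i)
    case 0
    have "strg (3 # bin c @ d # u) (Suc 0) = bin c"
      using set_bin[of c] assms(2) by (intro drop_bits) auto
    then show ?thesis using 0 by blast
  next
    case (Suc j)
    then have "\<exists>c'. strg (bin c @ d # u) (Suc j) = bin c'" using s i unfolding separated_def by auto
    then show ?thesis using Suc by (simp add: strg_def)
  qed
qed

lemma separated_enc_db: "separated (enc_db fs)"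
proof (induction fs)
  case Nil
  show ?case by (simp add: separated_def enc_db_def)
next
  case (Cons f fs)
  have 4: "separated (4 # enc_db fs)" using separated_append[of "[4]"] Cons by simp
  have "separated (enc_args cs @ 4 # enc_db fs)" for cs
  proof (induction cs)
    case (Cons c cs)
    then show ?case using separated_arg[of 4 "enc_db fs" c] separated_arg[of 3 _ c]
      by (cases cs) auto
  qed (use 4 in simp)
  moreover have "3 \<notin> set (bin (fst f))" using set_bin[of "fst f"] by auto
  ultimately show ?case using separated_append by (simp add: enc_db_Cons enc_fact_def)
qed

text \<open>Being the start of a fact becomes a local property, because 4 occurs only as the last
  symbol of a fact.\<close>

lemma start_iff_offs:
  "a < length (enc_db fs) \<and> (a = 0 \<or> enc_db fs ! (a - 1) = 4) \<longleftrightarrow> (\<exists>k<length fs. a = offs fs k)"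
proof (induction fs arbitrary: a)
  case Nil
  show ?case by (simp add: enc_db_def)
next
  case (Cons f fs)
  define u where "u = bin (fst f) @ enc_args (snd f)"
  have "4 \<notin> set (bin (fst f))" "4 \<notin> set (enc_args (snd f))"
    using set_bin[of "fst f"] set_enc_args[of "snd f"] by (auto simp del: set_concat set_map)
  then have u: "4 \<notin> set u" by (simp only: u_def set_append Un_iff simp_thms)
  have e: "enc_fact f = u @ [4]" by (simp add: enc_fact_def u_def)
  have ex: "(\<exists>k<length (f # fs). a = offs (f # fs) k) \<longleftrightarrow>
      a = 0 \<or> (\<exists>k<length fs. a = Suc (length u) + offs fs k)"
  proof -
    have "offs (f # fs) 0 = 0" "offs (f # fs) (Suc k) = Suc (length u) + offs fs k" for k
      by (simp_all add: offs_def enc_db_Cons e, simp add: enc_db_def)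
    then show ?thesis by (simp add: Ex_less_Suc2)
  qed
  consider "a = 0" | "0 < a" "a \<le> length u" | a' where "a = Suc (length u) + a'"
    by (metis le_Suc_ex not_gr0 not_less_eq_eq)
  then show ?case
  proof cases
    case 1
    then show ?thesis unfolding ex by (simp add: enc_db_Cons e)
  next
    case 2
    then have "u ! (a - 1) \<in> set u" by (intro nth_mem) linarith
    then have "u ! (a - 1) \<noteq> 4" using u by metis
    then show ?thesis unfolding ex using 2 by (auto simp: enc_db_Cons e nth_append)
  next
    case 3
    \<comment> \<open>For \<open>a' = 0\<close> the preceding symbol is the closing 4 of
      \<open>f\<close>, in agreement with the start of \<open>fs\<close> at position 0.\<close>
    have "a < length (enc_db (f # fs)) \<and> (a = 0 \<or> enc_db (f # fs) ! (a - 1) = 4) \<longleftrightarrow>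
        a' < length (enc_db fs) \<and> (a' = 0 \<or> enc_db fs ! (a' - 1) = 4) \<or> (a' = 0 \<and> fs = [] \<and> False)"
      using 3 length_enc_db_0[of fs] by (cases a') (auto simp: enc_db_Cons e nth_append)
    then show ?thesis unfolding ex using Cons[of a'] 3 by auto
  qed
qed

text \<open>Every encoded fact contains at least its closing symbol, so offsets increase
  strictly.\<close>

lemma offs_inj:
  assumes "k < length fs" "l < length fs" "offs fs k = offs fs l"
  shows "k = l"
proof -
  have "offs fs k < offs fs l" if "k < l" "l < length fs" for k l
  proof -
    have "take l fs = take k fs @ take (l - k) (drop k fs)"
      using that by (metis le_add_diff_inverse less_imp_le take_add)
    moreover have "enc_db (take (l - k) (drop k fs)) \<noteq> []"
      using that by (simp add: length_enc_db_0)
    ultimately show ?thesis by (simp add: offs_def enc_db_append)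
  qed
  then show ?thesis using assms by (metis less_irrefl linorder_neqE_nat)
qed

section \<open>Repairs of linear dependencies\<close>

text \<open>The body is tested in the single fact \<open>x\<close>, the head in all of
  \<open>F\<close>; only the second test depends on \<open>F\<close>, which makes the notion
  antitone in \<open>F\<close>.\<close>

definition violates :: "dep set \<Rightarrow> fact set \<Rightarrow> fact \<Rightarrow> bool" where
  "violates \<Sigma> F x \<longleftrightarrow> (\<exists>d\<in>\<Sigma>. \<exists>\<nu>. holds_conj {x} \<nu> (fst d) \<and> \<not> holds_ucq F \<nu> (snd d))"

lemma holds_lit_mono: "holds_lit F \<nu> l \<Longrightarrow> F \<subseteq> G \<Longrightarrow> holds_lit G \<nu> l"
  by (cases l) auto

lemma holds_conj_mono: "holds_conj F \<nu> g \<Longrightarrow> F \<subseteq> G \<Longrightarrow> holds_conj G \<nu> g"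
  using holds_lit_mono by (auto simp: holds_conj_def)

lemma holds_ucq_mono: "holds_ucq F \<nu> Q \<Longrightarrow> F \<subseteq> G \<Longrightarrow> holds_ucq G \<nu> Q"
  unfolding holds_ucq_def holds_cq_def using holds_conj_mono by blast

lemma violates_antimono: "violates \<Sigma> G x \<Longrightarrow> F \<subseteq> G \<Longrightarrow> violates \<Sigma> F x"
  unfolding violates_def using holds_ucq_mono by blast

text \<open>Inequalities ignore the fact set, so the fact matched by the only atom satisfies the
  whole conjunction by itself.\<close>

lemma holds_conj_single_atom:
  assumes "length (filter is_atom g) = 1"
  shows "holds_conj F \<nu> g \<longleftrightarrow> (\<exists>x\<in>F. holds_conj {x} \<nu> g)"
proof
  assume h: "holds_conj F \<nu> g"
  obtain a where a: "filter is_atom g = [a]"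
    using assms by (cases "filter is_atom g") auto
  then have "a \<in> set g" "is_atom a" using filter_eq_ConsD[OF a] by auto
  from this(2) obtain p ts where pt: "a = Atm p ts" by (cases a) auto
  have "(p, map (eval_trm \<nu>) ts) \<in> F" using h \<open>a \<in> set g\<close> pt by (auto simp: holds_conj_def)
  moreover have "holds_lit {(p, map (eval_trm \<nu>) ts)} \<nu> l" if "l \<in> set g" for l
  proof (cases "is_atom l")
    case True
    then have "l \<in> set (filter is_atom g)" using that by simp
    then show ?thesis using a pt by simp
  next
    case False
    then show ?thesis using h that by (cases l) (auto simp: holds_conj_def)
  qed
  ultimately show "\<exists>x\<in>F. holds_conj {x} \<nu> g" unfolding holds_conj_def by blast
next
  show "\<exists>x\<in>F. holds_conj {x} \<nu> g \<Longrightarrow> holds_conj F \<nu> g" using holds_conj_mono by blast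
qed

lemma consistent_iff:
  assumes "\<forall>d\<in>\<Sigma>. linear_dep d"
  shows "consistent \<Sigma> F \<longleftrightarrow> (\<forall>x\<in>F. \<not> violates \<Sigma> F x)"
proof -
  have "holds_conj F \<nu> (fst d) \<longleftrightarrow> (\<exists>x\<in>F. holds_conj {x} \<nu> (fst d))" if "d \<in> \<Sigma>" for d \<nu>
    using assms that holds_conj_single_atom unfolding linear_dep_def by blast
  then show ?thesis unfolding consistent_def dep_sat_def violates_def by blast
qed

definition max_consistent :: "dep set \<Rightarrow> fact set \<Rightarrow> fact set" where
  "max_consistent \<Sigma> D = \<Union>{F. F \<subseteq> D \<and> consistent \<Sigma> F}"

text \<open>A violation in the union would, by antitonicity, already be one in the consistent set
  that contributes the fact.\<close>

lemma consistent_max: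
  assumes "\<forall>d\<in>\<Sigma>. linear_dep d"
  shows "consistent \<Sigma> (max_consistent \<Sigma> D)"
  unfolding consistent_iff[OF assms]
proof
  fix x assume "x \<in> max_consistent \<Sigma> D"
  then obtain F where F: "F \<subseteq> D" "consistent \<Sigma> F" "x \<in> F" by (auto simp: max_consistent_def)
  then have "\<not> violates \<Sigma> F x" using consistent_iff[OF assms] by blast
  moreover have "F \<subseteq> max_consistent \<Sigma> D" using F by (auto simp: max_consistent_def)
  ultimately show "\<not> violates \<Sigma> (max_consistent \<Sigma> D) x" using violates_antimono by blast
qed

lemma is_repair_iff:
  assumes "\<forall>d\<in>\<Sigma>. linear_dep d"
  shows "is_repair \<Sigma> D R \<longleftrightarrow> R = max_consistent \<Sigma> D"
proof -
  let ?U = "max_consistent \<Sigma> D"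
  have U: "?U \<subseteq> D" by (auto simp: max_consistent_def)
  have max: "F \<subseteq> ?U" if "F \<subseteq> D" "consistent \<Sigma> F" for F
    using that by (auto simp: max_consistent_def)
  show ?thesis
  proof
    assume R: "is_repair \<Sigma> D R"
    then have "R \<subseteq> ?U" using max unfolding is_repair_def by simp
    moreover have "\<not> R \<subset> ?U" using R U consistent_max[OF assms, of D] unfolding is_repair_def by metis
    ultimately show "R = ?U" by auto
  next
    assume "R = ?U"
    then show "is_repair \<Sigma> D R"
      using U max consistent_max[OF assms, of D] unfolding is_repair_def by (metis less_le_not_le)
  qed
qed

lemma IAR_entails_iff:
  assumes "\<forall>d\<in>\<Sigma>. linear_dep d"
  shows "IAR_entails \<Sigma> D Q \<longleftrightarrow> sat_bucq (max_consistent \<Sigma> D) Q"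
  unfolding IAR_entails_def is_repair_iff[OF assms] by simp

section \<open>Constants, variables and the identification of values\<close>

fun consts_trm :: "trm \<Rightarrow> nat set" where
  "consts_trm (Cst c) = {c}"
| "consts_trm (Var v) = {}"

fun consts_lit :: "lit \<Rightarrow> nat set" where
  "consts_lit (Atm p ts) = (\<Union>t\<in>set ts. consts_trm t)"
| "consts_lit (Neq t u) = consts_trm t \<union> consts_trm u"

definition consts_conj :: "conj \<Rightarrow> nat set" where
  "consts_conj g = (\<Union>l\<in>set g. consts_lit l)"

definition consts_ucq :: "ucq \<Rightarrow> nat set" where
  "consts_ucq Q = (\<Union>q\<in>set Q. consts_conj (snd q))"

lemma finite_consts: "finite (consts_conj g)" "finite (consts_ucq Q)"
proof -
  have t: "finite (consts_trm t)" for t by (cases t) auto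
  have l: "finite (consts_lit l)" for l using t by (cases l) auto
  show g: "finite (consts_conj g)" for g using l by (simp add: consts_conj_def)
  show "finite (consts_ucq Q)" using g by (simp add: consts_ucq_def)
qed

lemma finite_vars: "finite (vars_conj g)" "finite (fv_ucq Q)"
proof -
  have t: "finite (vars_trm t)" for t by (cases t) auto
  have l: "finite (vars_lit l)" for l using t by (cases l) auto
  show g: "finite (vars_conj g)" for g using l by (simp add: vars_conj_def)
  show "finite (fv_ucq Q)" using g by (simp add: fv_ucq_def fv_cq_def)
qed

lemma eval_trm_cong: "(\<And>v. v \<in> vars_trm t \<Longrightarrow> \<mu> v = \<nu> v) \<Longrightarrow> eval_trm \<mu> t = eval_trm \<nu> t"
  by (cases t) auto

lemma holds_lit_cong:
  assumes "\<And>v. v \<in> vars_lit l \<Longrightarrow> \<mu> v = \<nu> v"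
  shows "holds_lit F \<mu> l \<longleftrightarrow> holds_lit F \<nu> l"
proof (cases l)
  case (Atm p ts)
  have m: "map (eval_trm \<mu>) ts = map (eval_trm \<nu>) ts"
    using assms Atm by (intro map_cong refl eval_trm_cong) auto
  show ?thesis unfolding Atm holds_lit.simps m ..
next
  case (Neq t u)
  then show ?thesis using assms eval_trm_cong[of t \<mu> \<nu>] eval_trm_cong[of u \<mu> \<nu>] by simp
qed

lemma holds_conj_cong:
  "(\<And>v. v \<in> vars_conj g \<Longrightarrow> \<mu> v = \<nu> v) \<Longrightarrow> holds_conj F \<mu> g \<longleftrightarrow> holds_conj F \<nu> g"
  unfolding holds_conj_def vars_conj_def by (intro ball_cong refl holds_lit_cong) auto

text \<open>Confines the values of safe variables to the constants of the facts, and thereby the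
  search to finitely many candidates.\<close>

lemma atom_var_value:
  assumes "holds_conj F \<mu> g" "v \<in> atom_vars g"
  shows "\<exists>x\<in>F. \<mu> v \<in> set (snd x)"
proof -
  obtain l where l: "l \<in> set g" "is_atom l" "v \<in> vars_lit l"
    using assms(2) by (auto simp: atom_vars_def split: if_splits)
  from this(2) obtain p ts where pt: "l = Atm p ts" by (cases l) auto
  obtain t where t: "t \<in> set ts" "v \<in> vars_trm t" using l pt by auto
  from this(2) have "t = Var v" by (cases t) auto
  then have "\<mu> v \<in> set (map (eval_trm \<mu>) ts)" using t by force
  moreover have "(p, map (eval_trm \<mu>) ts) \<in> F" using assms(1) l pt by (auto simp: holds_conj_def)
  ultimately show ?thesis by force
qed

text \<open>Identifying all values outside \<open>L\<close> with one fresh value only makes inequalities false,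
  so it cannot turn a false head into a true one.\<close>

lemma holds_ucq_collapse:
  assumes h: "holds_ucq F \<nu>' Q"
    and safe: "\<forall>q\<in>set Q. set (fst q) \<subseteq> atom_vars (snd q)"
    and L: "consts_ucq Q \<subseteq> L" "\<forall>x\<in>F. set (snd x) \<subseteq> L" "f \<notin> L"
    and \<nu>': "\<forall>v\<in>fv_ucq Q. \<nu>' v = (if \<nu> v \<in> L then \<nu> v else f)"
  shows "holds_ucq F \<nu> Q"
proof -
  obtain q \<mu>' where q: "q \<in> set Q" "\<forall>v. v \<notin> set (fst q) \<longrightarrow> \<mu>' v = \<nu>' v" "holds_conj F \<mu>' (snd q)"
    using h unfolding holds_ucq_def holds_cq_def by blast
  define \<pi> where "\<pi> x = (if x \<in> L then x else f)" for x
  define \<mu> where "\<mu> v = (if v \<in> set (fst q) then \<mu>' v else \<nu> v)" for v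
  \<comment> \<open>A quantified variable occurs in an atom, so its value lies in \<open>L\<close>
    and is fixed by \<open>\<pi>\<close>; for a free variable this is the assumption on
    \<open>\<nu>'\<close>.\<close>
  have v: "\<mu>' v = \<pi> (\<mu> v)" if "v \<in> vars_conj (snd q)" for v
  proof (cases "v \<in> set (fst q)")
    case True
    then have "\<mu>' v \<in> L" using atom_var_value[OF q(3), of v] safe q(1) L(2) by blast
    then show ?thesis using True by (simp add: \<mu>_def \<pi>_def)
  next
    case False
    then have "v \<in> fv_ucq Q" using that q(1) by (auto simp: fv_ucq_def fv_cq_def)
    then show ?thesis using False q(2) \<nu>' by (simp add: \<mu>_def \<pi>_def)
  qed
  have t: "eval_trm \<mu>' t = \<pi> (eval_trm \<mu> t)"
    if "vars_trm t \<subseteq> vars_conj (snd q)" "consts_trm t \<subseteq> consts_conj (snd q)" for t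
    using that v L(1) q(1) by (cases t) (auto simp: \<pi>_def consts_ucq_def)
  have "holds_lit F \<mu> l" if l: "l \<in> set (snd q)" for l
  proof -
    have h: "holds_lit F \<mu>' l" using q(3) l by (auto simp: holds_conj_def)
    have vl: "vars_lit l \<subseteq> vars_conj (snd q)" "consts_lit l \<subseteq> consts_conj (snd q)"
      using l by (auto simp: vars_conj_def consts_conj_def)
    show ?thesis
    proof (cases l)
      case (Atm p ts)
      \<comment> \<open>In an atom the collapsed value is a constant of \<open>F\<close>, hence in
        \<open>L\<close> and different from \<open>f\<close>; so nothing was collapsed
        there.\<close>
      have "eval_trm \<mu> t = eval_trm \<mu>' t" if "t \<in> set ts" for t
      proof -
        have "eval_trm \<mu>' t \<in> L" using h Atm L(2) that by fastforce
        moreover have "eval_trm \<mu>' t = \<pi> (eval_trm \<mu> t)" using vl Atm that by (intro t) auto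
        ultimately show ?thesis using L(3) by (auto simp: \<pi>_def split: if_splits)
      qed
      then have m: "map (eval_trm \<mu>) ts = map (eval_trm \<mu>') ts" by simp
      show ?thesis using h unfolding Atm holds_lit.simps m .
    next
      case (Neq s u)
      then show ?thesis using h vl t[of s] t[of u] by auto
    qed
  qed
  then have "holds_conj F \<mu> (snd q)" by (simp add: holds_conj_def)
  then show ?thesis unfolding holds_ucq_def holds_cq_def
    using q(1) by (intro bexI[of _ q] exI[of _ \<mu>]) (auto simp: \<mu>_def)
qed

section \<open>Translation of dependencies and queries\<close>

definition TTf :: fm where "TTf = Neg FF"
definition Orf :: "fm \<Rightarrow> fm \<Rightarrow> fm" where "Orf \<phi> \<psi> = Neg (And (Neg \<phi>) (Neg \<psi>))"
definition Ands :: "fm list \<Rightarrow> fm" where "Ands \<phi>s = foldr And \<phi>s TTf"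
definition Ors :: "fm list \<Rightarrow> fm" where "Ors \<phi>s = foldr Orf \<phi>s FF"

lemma sem_TTf[simp]: "sem w D \<rho> TTf"
  by (simp add: TTf_def)

lemma sem_Ands[simp]: "sem w D \<rho> (Ands \<phi>s) \<longleftrightarrow> (\<forall>\<phi>\<in>set \<phi>s. sem w D \<rho> \<phi>)"
  unfolding Ands_def by (induction \<phi>s) auto

lemma sem_Ors[simp]: "sem w D \<rho> (Ors \<phi>s) \<longleftrightarrow> (\<exists>\<phi>\<in>set \<phi>s. sem w D \<rho> \<phi>)"
  unfolding Ors_def by (induction \<phi>s) (auto simp: Orf_def)

lemma wfm_TTf[simp]: "wfm d TTf"
  by (simp add: TTf_def)

lemma wfm_Ands[simp]: "wfm d (Ands \<phi>s) \<longleftrightarrow> (\<forall>\<phi>\<in>set \<phi>s. wfm d \<phi>)"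
  unfolding Ands_def by (induction \<phi>s) auto

lemma wfm_Ors[simp]: "wfm d (Ors \<phi>s) \<longleftrightarrow> (\<forall>\<phi>\<in>set \<phi>s. wfm d \<phi>)"
  unfolding Ors_def by (induction \<phi>s) (auto simp: Orf_def)

text \<open>The closing test for a non-bit excludes strings of which \<open>bs\<close> is merely a
  proper prefix.\<close>

fun lit_at :: "nat \<Rightarrow> nat list \<Rightarrow> nat \<Rightarrow> fm" where
  "lit_at x [] d = Sym x {2<..}"
| "lit_at x (b # bs) d = And (Sym x {b}) (Exists d (And (Succ x d) (lit_at d bs (Suc d))))"

text \<open>The counterpart of \<open>apos\<close> as a formula.\<close>

fun arg_at :: "nat \<Rightarrow> nat \<Rightarrow> nat \<Rightarrow> nat \<Rightarrow> fm" where
  "arg_at a 0 y d = Nd a y"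
| "arg_at a (Suc i) y d = Exists d (And (arg_at a i d (Suc d)) (Exists (Suc d) (And (Succ d (Suc d)) (Nd (Suc d) y))))"

text \<open>A term denotes the constant at a separator position, a constant of the query or the
  dependencies, or the fresh value.\<close>

datatype code = PtrC nat | CstC nat | FrC

fun eqf :: "nat \<Rightarrow> code \<Rightarrow> code \<Rightarrow> fm" where
  "eqf d (PtrC x) (PtrC y) = EqS x y"
| "eqf d (PtrC x) (CstC c) = Exists d (And (Succ x d) (lit_at d (bin c) (Suc d)))"
| "eqf d (CstC c) (PtrC x) = Exists d (And (Succ x d) (lit_at d (bin c) (Suc d)))"
| "eqf d (CstC c) (CstC e) = (if c = e then TTf else FF)"
| "eqf d FrC FrC = TTf"
| "eqf d _ _ = FF"

text \<open>The number of arguments on the tape is not compared, since the predicate determines it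
  through the arity.\<close>

definition fact_atf :: "nat \<Rightarrow> nat \<Rightarrow> nat \<Rightarrow> code list \<Rightarrow> fm" where
  "fact_atf a d p cs = And (lit_at a (bin p) d)
     (Ands (map (\<lambda>i. Exists d (And (arg_at a i d (Suc d)) (eqf (Suc d) (PtrC d) (cs ! i)))) [0..<length cs]))"

text \<open>Position 0 qualifies because it has no predecessor at all.\<close>

definition startf :: "nat \<Rightarrow> nat \<Rightarrow> fm" where
  "startf a d = Neg (Exists d (And (Succ d a) (Neg (Sym d {4}))))"

definition factf :: "nat \<Rightarrow> nat \<Rightarrow> code list \<Rightarrow> fm" where
  "factf d p cs = Exists d (And (startf d (Suc d)) (And (Neg (Dead d)) (fact_atf d (Suc d) p cs)))"

fun tcode :: "(nat \<Rightarrow> code) \<Rightarrow> trm \<Rightarrow> code" where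
  "tcode \<kappa> (Cst c) = CstC c"
| "tcode \<kappa> (Var v) = \<kappa> v"

fun litf :: "(nat \<Rightarrow> nat \<Rightarrow> code list \<Rightarrow> fm) \<Rightarrow> (nat \<Rightarrow> code) \<Rightarrow> nat \<Rightarrow> lit \<Rightarrow> fm" where
  "litf M \<kappa> d (Atm Bot ts) = FF"
| "litf M \<kappa> d (Atm (Pr p) ts) = M d p (map (tcode \<kappa>) ts)"
| "litf M \<kappa> d (Neq t u) = Neg (eqf d (tcode \<kappa> t) (tcode \<kappa> u))"

definition conjf :: "(nat \<Rightarrow> nat \<Rightarrow> code list \<Rightarrow> fm) \<Rightarrow> (nat \<Rightarrow> code) \<Rightarrow> nat \<Rightarrow> conj \<Rightarrow> fm" where
  "conjf M \<kappa> d g = Ands (map (litf M \<kappa> d) g)"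

text \<open>A quantifier over values splits into a search over separators and finitely many symbolic
  choices; only the search binds a pointer and raises the depth \<open>d\<close>.\<close>

fun exf :: "nat list \<Rightarrow> nat list \<Rightarrow> (nat \<Rightarrow> code) \<Rightarrow> nat \<Rightarrow> ((nat \<Rightarrow> code) \<Rightarrow> nat \<Rightarrow> fm) \<Rightarrow> fm" where
  "exf C [] \<kappa> d body = body \<kappa> d"
| "exf C (v # vs) \<kappa> d body = Ors
     (Exists d (And (Sym d {3}) (exf C vs (\<kappa>(v := PtrC d)) (Suc d) body)) #
      map (\<lambda>c. exf C vs (\<kappa>(v := c)) d body) (FrC # map CstC C))"

definition ucqf :: "nat list \<Rightarrow> (nat \<Rightarrow> code) \<Rightarrow> nat \<Rightarrow> ucq \<Rightarrow> fm" where
  "ucqf C \<kappa> d Q = Ors (map (\<lambda>q. exf C (fst q) \<kappa> d (\<lambda>\<kappa> d. conjf factf \<kappa> d (snd q))) Q)"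

definition dep_vars :: "dep \<Rightarrow> nat list" where
  "dep_vars \<delta> = sorted_list_of_set (vars_conj (fst \<delta>) \<union> fv_ucq (snd \<delta>))"

definition violf :: "nat list \<Rightarrow> nat \<Rightarrow> nat \<Rightarrow> dep list \<Rightarrow> fm" where
  "violf C a d \<Delta> = Ors (map (\<lambda>\<delta>. exf C (dep_vars \<delta>) (\<lambda>_. FrC) d
     (\<lambda>\<kappa> d. And (conjf (fact_atf a) \<kappa> d (fst \<delta>)) (Neg (ucqf C \<kappa> d (snd \<delta>))))) \<Delta>)"

section \<open>Scoping of the formulas\<close>

fun code_ok :: "nat \<Rightarrow> code \<Rightarrow> bool" where
  "code_ok d (PtrC x) = (x < d)"
| "code_ok d _ = True"

lemma code_ok_mono: "code_ok d c \<Longrightarrow> d \<le> d' \<Longrightarrow> code_ok d' c"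
  by (cases c) auto

lemma wfm_lit_at: "x < d \<Longrightarrow> wfm d (lit_at x bs d)"
  by (induction bs arbitrary: x d) auto

lemma wfm_arg_at: "a < d \<Longrightarrow> y < d \<Longrightarrow> wfm d (arg_at a i y d)"
  by (induction i arbitrary: y d) auto

lemma wfm_eqf: "code_ok d c \<Longrightarrow> code_ok d e \<Longrightarrow> wfm d (eqf d c e)"
  by (cases "(d, c, e)" rule: eqf.cases) (auto intro: wfm_lit_at)

lemma wfm_fact_atf:
  assumes "a < d" "\<forall>c\<in>set cs. code_ok d c"
  shows "wfm d (fact_atf a d p cs)"
proof -
  have "code_ok (Suc d) (cs ! i)" if "i < length cs" for i
    using assms(2) that code_ok_mono[of d "cs ! i" "Suc d"] by auto
  then show ?thesis using assms(1) by (auto simp: fact_atf_def intro!: wfm_lit_at wfm_arg_at wfm_eqf)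
qed

lemma wfm_startf: "a < d \<Longrightarrow> wfm d (startf a d)"
  by (simp add: startf_def)

lemma wfm_factf:
  assumes "\<forall>c\<in>set cs. code_ok d c"
  shows "wfm d (factf d p cs)"
proof -
  have "\<forall>c\<in>set cs. code_ok (Suc d) c" using assms code_ok_mono[of d _ "Suc d"] by auto
  then show ?thesis by (simp add: factf_def wfm_startf wfm_fact_atf)
qed

lemma wfm_conjf:
  assumes "\<And>p cs. \<forall>c\<in>set cs. code_ok d c \<Longrightarrow> wfm d (M d p cs)" "\<forall>v. code_ok d (\<kappa> v)"
  shows "wfm d (conjf M \<kappa> d g)"
proof -
  have t: "code_ok d (tcode \<kappa> t)" for t using assms(2) by (cases t) auto
  have "wfm d (litf M \<kappa> d l)" for l
    using t assms(1) by (cases "(M, \<kappa>, d, l)" rule: litf.cases) (auto intro: wfm_eqf)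
  then show ?thesis by (simp add: conjf_def)
qed

lemma wfm_exf:
  assumes "\<And>\<kappa> d'. d \<le> d' \<Longrightarrow> \<forall>v. code_ok d' (\<kappa> v) \<Longrightarrow> wfm d' (body \<kappa> d')"
    and "d \<le> d'" "\<forall>v. code_ok d' (\<kappa> v)"
  shows "wfm d' (exf C vs \<kappa> d' body)"
  using assms(2,3)
proof (induction vs arbitrary: \<kappa> d')
  case (Cons v vs)
  have "\<forall>u. code_ok (Suc d') ((\<kappa>(v := PtrC d')) u)"
    using Cons.prems code_ok_mono[of d' _ "Suc d'"] by auto
  then show ?case using Cons by simp
qed (use assms(1) in simp)

lemma wfm_ucqf: "\<forall>v. code_ok d (\<kappa> v) \<Longrightarrow> wfm d (ucqf C \<kappa> d Q)"
  unfolding ucqf_def by (auto intro!: wfm_exf[where d = d] wfm_conjf wfm_factf)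

lemma wfm_violf: "a < d \<Longrightarrow> wfm d (violf C a d \<Delta>)"
  unfolding violf_def by (auto intro!: wfm_exf[where d = d] wfm_conjf wfm_ucqf wfm_fact_atf)

section \<open>Meaning of the formulas\<close>

locale database =
  fixes fs :: "(nat \<times> nat list) list" and ar :: "nat \<Rightarrow> nat" and C :: "nat list" and f :: nat and w :: "nat list"
  assumes ne: "fs \<noteq> []" and wf: "wf_db_list ar fs" and w_def: "w = enc_db fs"
    and fresh: "f \<notin> set C" "i < length w \<Longrightarrow> w ! i = 3 \<Longrightarrow> strg w (Suc i) \<noteq> bin f"

sublocale database \<subseteq> dword w
  unfolding w_def by (rule dword_enc_db[OF ne])

context database
begin

definition val_at :: "nat \<Rightarrow> nat" where
  "val_at i = (THE c. bin c = strg w (Suc i))"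

lemma bin_val_at:
  assumes "i < n" "w ! i = 3"
  shows "bin (val_at i) = strg w (Suc i)" "Suc i < n"
proof -
  obtain c where "strg w (Suc i) = bin c"
    using separated_enc_db[of fs] assms unfolding separated_def w_def by auto
  then show "bin (val_at i) = strg w (Suc i)" by (simp add: val_at_def bin_inject)
  show "Suc i < n"
    using assms w_last w_ne by (metis Suc_lessI diff_Suc_1 last_conv_nth numeral_eq_iff semiring_norm(85) semiring_norm(88) num.distinct)
qed

definition low :: "nat set" where
  "low = val_at ` {i. i < n \<and> w ! i = 3} \<union> set C"

lemma fresh_low: "f \<notin> low"
  using fresh bin_val_at(1) unfolding low_def by fastforce

text \<open>Deletion works on positions, so a fact listed several times survives until all its
  occurrences are dead.\<close>

definition alive :: "nat set \<Rightarrow> fact set" where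
  "alive D = {(Pr p, cs) | p cs. \<exists>k<length fs. fs ! k = (p, cs) \<and> offs fs k \<notin> D}"

fun val :: "(nat \<Rightarrow> nat) \<Rightarrow> code \<Rightarrow> nat" where
  "val \<rho> (PtrC x) = val_at (\<rho> x)"
| "val \<rho> (CstC c) = c"
| "val \<rho> FrC = f"

fun valid :: "(nat \<Rightarrow> nat) \<Rightarrow> nat \<Rightarrow> code \<Rightarrow> bool" where
  "valid \<rho> d (PtrC x) = (x < d \<and> \<rho> x < n \<and> w ! \<rho> x = 3)"
| "valid \<rho> d (CstC c) = (c \<in> set C)"
| "valid \<rho> d FrC = True"

lemma valid_upd: "valid \<rho> d c \<Longrightarrow> d \<le> x \<Longrightarrow> valid (\<rho>(x := p)) (Suc x) c"
  by (cases c) auto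

lemma val_upd: "valid \<rho> d c \<Longrightarrow> d \<le> x \<Longrightarrow> val (\<rho>(x := p)) c = val \<rho> c"
  by (cases c) auto

lemma sem_lit_at:
  "x < d \<Longrightarrow> \<rho> x < n \<Longrightarrow> set bs \<subseteq> {1, 2} \<Longrightarrow> sem w D \<rho> (lit_at x bs d) \<longleftrightarrow> strg w (\<rho> x) = bs"
proof (induction bs arbitrary: x d \<rho>)
  case Nil
  then show ?case by (simp add: strg_step)
next
  case (Cons b bs)
  have IH: "sem w D (\<rho>(d := p)) (lit_at d bs (Suc d)) \<longleftrightarrow> strg w p = bs" if "p < n" for p
    using Cons.IH[of d "Suc d" "\<rho>(d := p)"] that Cons.prems by (simp add: fun_upd_def)
  have b: "b \<le> 2" using Cons.prems by auto
  have "sem w D \<rho> (lit_at x (b # bs) d) \<longleftrightarrow> w ! \<rho> x = b \<and> Suc (\<rho> x) < n \<and> strg w (Suc (\<rho> x)) = bs"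
    using IH Cons.prems by auto
  then show ?case using strg_step[OF Cons.prems(2)] bit_next[OF Cons.prems(2)] b by auto
qed

text \<open>The intermediate positions are witnesses of quantifiers that range over the word only,
  hence the bound on them.\<close>

lemma sem_arg_at:
  assumes "a < d" "y < d" "\<forall>j<i. Suc (apos w (\<rho> a) j) < n"
  shows "sem w D \<rho> (arg_at a i y d) \<longleftrightarrow> \<rho> y = apos w (\<rho> a) i"
  using assms
proof (induction i arbitrary: y d \<rho>)
  case (Suc i)
  have IH: "sem w D (\<rho>(d := p)) (arg_at a i d (Suc d)) \<longleftrightarrow> p = apos w (\<rho> a) i" for p
    using Suc.IH[of "Suc d" d "\<rho>(d := p)"] Suc.prems by (simp add: fun_upd_def)
  have "Suc (apos w (\<rho> a) i) < n" using Suc.prems by simp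
  then show ?case using IH Suc.prems by (auto intro: Suc_lessD)
qed simp

lemma sem_eq_const:
  assumes "valid \<rho> d (PtrC x)"
  shows "sem w D \<rho> (Exists d (And (Succ x d) (lit_at d (bin c) (Suc d)))) \<longleftrightarrow> val_at (\<rho> x) = c"
proof -
  have x: "x < d" "\<rho> x < n" "w ! \<rho> x = 3" using assms by auto
  have "sem w D (\<rho>(d := p)) (lit_at d (bin c) (Suc d)) \<longleftrightarrow> strg w p = bin c" if "p < n" for p
    using sem_lit_at[of d "Suc d" "\<rho>(d := p)" "bin c"] set_bin that by simp
  then show ?thesis using bin_val_at[OF x(2,3)] x(1) bin_inject by auto
qed

lemma val_at_low: "valid \<rho> d (PtrC x) \<Longrightarrow> val_at (\<rho> x) \<in> low"
  by (auto simp: low_def)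

text \<open>Pointers and constants of \<open>C\<close> denote elements of \<open>low\<close>, so
  only \<open>FrC\<close> equals \<open>FrC\<close>; this justifies the default case FF.\<close>

lemma sem_eqf:
  assumes "valid \<rho> d c" "valid \<rho> d e"
  shows "sem w D \<rho> (eqf d c e) \<longleftrightarrow> val \<rho> c = val \<rho> e"
proof (cases "(d, c, e)" rule: eqf.cases)
  case (1 d' x y)
  then show ?thesis using assms bin_val_at[of "\<rho> x"] bin_val_at[of "\<rho> y"]
    by simp (metis bin_inject)
next
  case (2 d' x c')
  then show ?thesis using assms sem_eq_const[of \<rho> d x D c'] by simp
next
  case (3 d' c' x)
  then show ?thesis using assms sem_eq_const[of \<rho> d x D c'] by auto
qed (use assms val_at_low[of \<rho> d] fresh_low fresh(1) in \<open>auto simp: low_def\<close>)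

lemma sem_fact_atf:
  assumes "k < length fs" "fs ! k = (p', as)" "\<rho> a = offs fs k" "a < d"
    and "\<forall>c\<in>set cs. valid \<rho> d c" "length cs = ar p"
  shows "sem w D \<rho> (fact_atf a d p cs) \<longleftrightarrow> (Pr p, map (val \<rho>) cs) = (Pr p', as)"
proof -
  have a: "\<rho> a < n" using offs_less assms by (simp add: w_def)
  have as: "length as = ar p'" using wf assms(1,2) nth_mem[of k fs] by (auto simp: wf_db_list_def)
  have s: "strg w (\<rho> a) = bin p'" using fact_at_offs(1)[OF assms(1,2)] assms(3) by (simp add: w_def)
  have arg: "apos w (\<rho> a) i < n" "w ! apos w (\<rho> a) i = 3" "Suc (apos w (\<rho> a) i) < n"
    "strg w (Suc (apos w (\<rho> a) i)) = bin (as ! i)" if "i < length as" for i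
    using fact_at_offs(2)[OF assms(1,2) that] assms(3) by (simp_all add: w_def)
  have "sem w D \<rho> (Exists d (And (arg_at a i d (Suc d)) (eqf (Suc d) (PtrC d) (cs ! i)))) \<longleftrightarrow>
      val \<rho> (cs ! i) = as ! i" if i: "i < length cs" "p = p'" for i
  proof -
    have il: "i < length as" using i as assms(6) by simp
    have 1: "sem w D (\<rho>(d := q)) (arg_at a i d (Suc d)) \<longleftrightarrow> q = apos w (\<rho> a) i" for q
      using sem_arg_at[of a "Suc d" d i "\<rho>(d := q)"] assms(4) arg(3) il by simp
    let ?\<rho> = "\<rho>(d := apos w (\<rho> a) i)"
    have v: "valid \<rho> d (cs ! i)" using assms(5) i by simp
    have "sem w D ?\<rho> (eqf (Suc d) (PtrC d) (cs ! i)) \<longleftrightarrow> val_at (apos w (\<rho> a) i) = val \<rho> (cs ! i)"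
      using sem_eqf[of ?\<rho> "Suc d" "PtrC d" "cs ! i"] arg(1,2)[OF il] valid_upd[OF v] val_upd[OF v] by simp
    moreover have "val_at (apos w (\<rho> a) i) = as ! i"
      using bin_val_at(1)[OF arg(1,2)[OF il]] arg(4)[OF il] bin_inject by simp
    ultimately show ?thesis using 1 arg(1)[OF il] by auto
  qed
  moreover have "sem w D \<rho> (lit_at a (bin p) d) \<longleftrightarrow> p = p'"
    using sem_lit_at[of a d \<rho>, OF assms(4) a set_bin] s by (auto simp: bin_inject)
  ultimately have "sem w D \<rho> (fact_atf a d p cs) \<longleftrightarrow> p = p' \<and> (\<forall>i<length cs. val \<rho> (cs ! i) = as ! i)"
    unfolding fact_atf_def by auto
  also have "\<dots> \<longleftrightarrow> (Pr p, map (val \<rho>) cs) = (Pr p', as)"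
    using as assms(6) by (auto simp: list_eq_iff_nth_eq)
  finally show ?thesis .
qed

lemma sem_startf:
  assumes "a < d" "\<rho> a < n"
  shows "sem w D \<rho> (startf a d) \<longleftrightarrow> (\<exists>k<length fs. \<rho> a = offs fs k)"
proof -
  have "sem w D \<rho> (startf a d) \<longleftrightarrow> \<rho> a = 0 \<or> w ! (\<rho> a - 1) = 4"
    using assms by (cases "\<rho> a") (auto simp: startf_def)
  then show ?thesis using start_iff_offs[of "\<rho> a" fs] assms(2) by (simp add: w_def)
qed

lemma sem_factf:
  assumes "\<forall>c\<in>set cs. valid \<rho> d c" "length cs = ar p"
  shows "sem w D \<rho> (factf d p cs) \<longleftrightarrow> (Pr p, map (val \<rho>) cs) \<in> alive D"
proof -
  have v: "\<forall>c\<in>set cs. valid (\<rho>(d := q)) (Suc d) c" for q using assms(1) valid_upd by auto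
  have m: "map (val (\<rho>(d := q))) cs = map (val \<rho>) cs" for q using assms(1) val_upd by auto
  have at: "sem w D (\<rho>(d := offs fs k)) (fact_atf d (Suc d) p cs) \<longleftrightarrow>
      fs ! k = (p, map (val \<rho>) cs)" if "k < length fs" for k
    using sem_fact_atf[of k "fst (fs ! k)" "snd (fs ! k)" "\<rho>(d := offs fs k)" d "Suc d" cs p D]
      that v assms(2) unfolding m by (cases "fs ! k") auto
  have st: "sem w D (\<rho>(d := q)) (startf d (Suc d)) \<longleftrightarrow> (\<exists>k<length fs. q = offs fs k)" if "q < n" for q
    using sem_startf[of d "Suc d" "\<rho>(d := q)"] that by simp
  have o: "offs fs k < n" if "k < length fs" for k using offs_less that by (simp add: w_def)
  have "sem w D \<rho> (factf d p cs) \<longleftrightarrow>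
      (\<exists>k<length fs. offs fs k \<notin> D \<and> sem w D (\<rho>(d := offs fs k)) (fact_atf d (Suc d) p cs))"
    unfolding factf_def using st o by auto
  also have "\<dots> \<longleftrightarrow> (Pr p, map (val \<rho>) cs) \<in> alive D" using at by (auto simp: alive_def)
  finally show ?thesis .
qed

text \<open>Kept parametric in \<open>M\<close> and \<open>F\<close> because bodies are matched
  against the one fact under inspection, heads and queries against all facts alive.\<close>

lemma sem_conjf:
  assumes M: "\<And>p cs. \<forall>c\<in>set cs. valid \<rho> d c \<Longrightarrow> length cs = ar p \<Longrightarrow>
      sem w D \<rho> (M d p cs) \<longleftrightarrow> (Pr p, map (val \<rho>) cs) \<in> F"
    and F: "\<And>as. (Bot, as) \<notin> F" and "\<forall>v. valid \<rho> d (\<kappa> v)" "wf_conj ar g" "consts_conj g \<subseteq> set C"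
  shows "sem w D \<rho> (conjf M \<kappa> d g) \<longleftrightarrow> holds_conj F (\<lambda>v. val \<rho> (\<kappa> v)) g"
proof -
  have t: "val \<rho> (tcode \<kappa> t) = eval_trm (\<lambda>v. val \<rho> (\<kappa> v)) t" for t by (cases t) auto
  have vt: "valid \<rho> d (tcode \<kappa> t)" if "consts_trm t \<subseteq> set C" for t
    using that assms(3) by (cases t) auto
  have "sem w D \<rho> (litf M \<kappa> d l) \<longleftrightarrow> holds_lit F (\<lambda>v. val \<rho> (\<kappa> v)) l" if "l \<in> set g" for l
  proof -
    have l: "wf_lit ar l" "consts_lit l \<subseteq> set C"
      using that assms(4,5) by (auto simp: wf_conj_def consts_conj_def)
    show ?thesis
    proof (cases "(M, \<kappa>, d, l)" rule: litf.cases)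
      case (1 M' \<kappa>' d' ts)
      then show ?thesis using F by simp
    next
      case (2 M' \<kappa>' d' p ts)
      have "consts_trm t \<subseteq> set C" if "t \<in> set ts" for t using l(2) 2 that by auto
      then have "\<forall>c\<in>set (map (tcode \<kappa>) ts). valid \<rho> d c" using vt by simp
      then have "sem w D \<rho> (M d p (map (tcode \<kappa>) ts)) \<longleftrightarrow> (Pr p, map (val \<rho>) (map (tcode \<kappa>) ts)) \<in> F"
        using 2 l(1) by (intro M) auto
      moreover have "map (val \<rho>) (map (tcode \<kappa>) ts) = map (eval_trm (\<lambda>v. val \<rho> (\<kappa> v))) ts"
        using t by simp
      ultimately have "sem w D \<rho> (M d p (map (tcode \<kappa>) ts)) \<longleftrightarrow>
          (Pr p, map (eval_trm (\<lambda>v. val \<rho> (\<kappa> v))) ts) \<in> F" by (simp only:)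
      then show ?thesis using 2 by (simp del: map_map)
    next
      case (3 M' \<kappa>' d' s u)
      then show ?thesis using sem_eqf[OF vt[of s] vt[of u]] l(2) t by simp
    qed
  qed
  then show ?thesis by (simp add: conjf_def holds_conj_def)
qed

text \<open>Variables below \<open>e\<close> keep their values since the body may mention them, such
  as the pointer to the inspected fact. \<open>B\<close> is the body seen as a property of the
  assignment.\<close>

lemma sem_exf:
  assumes B: "\<And>\<kappa> d \<rho>'. e \<le> d \<Longrightarrow> \<forall>x<e. \<rho>' x = \<rho> x \<Longrightarrow> \<forall>v. valid \<rho>' d (\<kappa> v) \<Longrightarrow>
      sem w D \<rho>' (body \<kappa> d) \<longleftrightarrow> B (\<lambda>v. val \<rho>' (\<kappa> v))"
    and "e \<le> d" "\<forall>x<e. \<rho>' x = \<rho> x" "\<forall>v. valid \<rho>' d (\<kappa> v)"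
  shows "sem w D \<rho>' (exf C vs \<kappa> d body) \<longleftrightarrow>
     (\<exists>\<nu>. (\<forall>v\<in>set vs. \<nu> v \<in> insert f low) \<and> (\<forall>v. v \<notin> set vs \<longrightarrow> \<nu> v = val \<rho>' (\<kappa> v)) \<and> B \<nu>)"
  using assms(2-4)
proof (induction vs arbitrary: \<rho>' \<kappa> d)
  case Nil
  have "(\<forall>v. \<nu> v = val \<rho>' (\<kappa> v)) \<longleftrightarrow> \<nu> = (\<lambda>v. val \<rho>' (\<kappa> v))" for \<nu> by auto
  then show ?case using B[OF Nil] by simp
next
  case (Cons v vs)
  \<comment> \<open>If \<open>v\<close> occurs again in \<open>vs\<close>, the inner choice
    overrides \<open>c\<close> and the condition on \<open>v\<close> is void.\<close>
  define G where "G c \<longleftrightarrow> (\<exists>\<nu>. (\<forall>u\<in>set vs. \<nu> u \<in> insert f low) \<and>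
      (\<forall>u. u \<notin> set vs \<longrightarrow> \<nu> u = (if u = v then c else val \<rho>' (\<kappa> u))) \<and> B \<nu>)" for c
  have gen: "sem w D \<rho>1 (exf C vs \<kappa>1 d1 body) \<longleftrightarrow> G c"
    if "e \<le> d1" "\<forall>x<e. \<rho>1 x = \<rho> x" "\<forall>u. valid \<rho>1 d1 (\<kappa>1 u)"
      "\<forall>u. val \<rho>1 (\<kappa>1 u) = (if u = v then c else val \<rho>' (\<kappa> u))" for \<rho>1 \<kappa>1 d1 c
    unfolding Cons.IH[OF that(1-3)] G_def using that(4) by simp
  have p: "sem w D (\<rho>'(d := p)) (exf C vs (\<kappa>(v := PtrC d)) (Suc d) body) \<longleftrightarrow> G (val_at p)"
    if "p < n" "w ! p = 3" for p
  proof -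
    have "\<forall>u. valid (\<rho>'(d := p)) (Suc d) ((\<kappa>(v := PtrC d)) u)"
      using Cons.prems(3) that valid_upd[of \<rho>' d _ d p] by auto
    moreover have "val (\<rho>'(d := p)) ((\<kappa>(v := PtrC d)) u) = (if u = v then val_at p else val \<rho>' (\<kappa> u))" for u
      using Cons.prems(3) val_upd[of \<rho>' d _ d p] by auto
    ultimately show ?thesis using Cons.prems by (intro gen) auto
  qed
  have c: "sem w D \<rho>' (exf C vs (\<kappa>(v := c)) d body) \<longleftrightarrow> G (val \<rho>' c)" if "valid \<rho>' d c" for c
  proof -
    have "\<forall>u. valid \<rho>' d ((\<kappa>(v := c)) u)" using Cons.prems(3) that by simp
    moreover have "val \<rho>' ((\<kappa>(v := c)) u) = (if u = v then val \<rho>' c else val \<rho>' (\<kappa> u))" for u by simp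
    ultimately show ?thesis using Cons.prems by (intro gen) auto
  qed
  have "sem w D \<rho>' (exf C (v # vs) \<kappa> d body) \<longleftrightarrow>
      (\<exists>p<n. w ! p = 3 \<and> G (val_at p)) \<or> G f \<or> (\<exists>c\<in>set C. G c)"
    using p c[of FrC] c[of "CstC _"] by auto
  also have "\<dots> \<longleftrightarrow> (\<exists>c\<in>insert f low. G c)" by (auto simp: low_def)
  also have "\<dots> \<longleftrightarrow> (\<exists>\<nu>. (\<forall>u\<in>set (v # vs). \<nu> u \<in> insert f low) \<and>
      (\<forall>u. u \<notin> set (v # vs) \<longrightarrow> \<nu> u = val \<rho>' (\<kappa> u)) \<and> B \<nu>)"
  proof
    assume "\<exists>c\<in>insert f low. G c"
    then obtain c \<nu> where "c \<in> insert f low" "\<forall>u\<in>set vs. \<nu> u \<in> insert f low"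
      "\<forall>u. u \<notin> set vs \<longrightarrow> \<nu> u = (if u = v then c else val \<rho>' (\<kappa> u))" "B \<nu>" unfolding G_def by blast
    moreover from this have "\<nu> v \<in> insert f low" by (cases "v \<in> set vs") auto
    ultimately show "\<exists>\<nu>. (\<forall>u\<in>set (v # vs). \<nu> u \<in> insert f low) \<and>
      (\<forall>u. u \<notin> set (v # vs) \<longrightarrow> \<nu> u = val \<rho>' (\<kappa> u)) \<and> B \<nu>" by (intro exI[of _ \<nu>]) auto
  next
    assume "\<exists>\<nu>. (\<forall>u\<in>set (v # vs). \<nu> u \<in> insert f low) \<and>
      (\<forall>u. u \<notin> set (v # vs) \<longrightarrow> \<nu> u = val \<rho>' (\<kappa> u)) \<and> B \<nu>"
    then obtain \<nu> where "\<forall>u\<in>set (v # vs). \<nu> u \<in> insert f low"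
      "\<forall>u. u \<notin> set (v # vs) \<longrightarrow> \<nu> u = val \<rho>' (\<kappa> u)" "B \<nu>" by blast
    then have "G (\<nu> v)" "\<nu> v \<in> insert f low" unfolding G_def by (auto intro!: exI[of _ \<nu>])
    then show "\<exists>c\<in>insert f low. G c" by blast
  qed
  finally show ?case .
qed

lemma alive_low: "x \<in> alive D \<Longrightarrow> set (snd x) \<subseteq> low"
proof -
  assume "x \<in> alive D"
  then obtain p cs k where k: "x = (Pr p, cs)" "k < length fs" "fs ! k = (p, cs)"
    by (auto simp: alive_def)
  have "cs ! i \<in> low" if "i < length cs" for i
  proof -
    let ?q = "apos w (offs fs k) i"
    have q: "?q < n" "w ! ?q = 3" "strg w (Suc ?q) = bin (cs ! i)"
      using fact_at_offs(2)[OF k(2,3) that] by (simp_all add: w_def)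
    then have "val_at ?q = cs ! i" using bin_val_at(1)[of ?q] bin_inject by simp
    then have "cs ! i = val_at ?q" by simp
    then show ?thesis using q(1,2) unfolding low_def by blast
  qed
  then show ?thesis using k(1) by (auto simp: in_set_conv_nth)
qed

text \<open>This form of safety follows both from the condition on heads and from the condition on
  queries.\<close>

lemma sem_ucqf:
  assumes "\<forall>v. valid \<rho> d (\<kappa> v)" "wf_ucq ar Q" "consts_ucq Q \<subseteq> set C"
    and safe: "\<forall>q\<in>set Q. set (fst q) \<inter> vars_conj (snd q) \<subseteq> atom_vars (snd q)"
  shows "sem w D \<rho> (ucqf C \<kappa> d Q) \<longleftrightarrow> holds_ucq (alive D) (\<lambda>v. val \<rho> (\<kappa> v)) Q"
proof -
  have "sem w D \<rho> (exf C (fst q) \<kappa> d (\<lambda>\<kappa> d. conjf factf \<kappa> d (snd q))) \<longleftrightarrow>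
      holds_cq (alive D) (\<lambda>v. val \<rho> (\<kappa> v)) q" if q: "q \<in> set Q" for q
  proof -
    have w: "wf_conj ar (snd q)" "consts_conj (snd q) \<subseteq> set C"
      using q assms(2,3) by (auto simp: wf_ucq_def wf_cq_def consts_ucq_def)
    have "sem w D \<rho>' (conjf factf \<kappa>' d' (snd q)) \<longleftrightarrow> holds_conj (alive D) (\<lambda>v. val \<rho>' (\<kappa>' v)) (snd q)"
      if "\<forall>v. valid \<rho>' d' (\<kappa>' v)" for \<kappa>' d' \<rho>'
      using that w by (intro sem_conjf sem_factf) (auto simp: alive_def)
    then have "sem w D \<rho> (exf C (fst q) \<kappa> d (\<lambda>\<kappa> d. conjf factf \<kappa> d (snd q))) \<longleftrightarrow>
      (\<exists>\<nu>. (\<forall>v\<in>set (fst q). \<nu> v \<in> insert f low) \<and> (\<forall>v. v \<notin> set (fst q) \<longrightarrow> \<nu> v = val \<rho> (\<kappa> v)) \<and>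
        holds_conj (alive D) \<nu> (snd q))"
      using assms(1) by (intro sem_exf[where e = d and \<rho> = \<rho>]) auto
    also have "\<dots> \<longleftrightarrow> holds_cq (alive D) (\<lambda>v. val \<rho> (\<kappa> v)) q"
    proof
      assume "holds_cq (alive D) (\<lambda>v. val \<rho> (\<kappa> v)) q"
      then obtain \<mu> where \<mu>: "\<forall>v. v \<notin> set (fst q) \<longrightarrow> \<mu> v = val \<rho> (\<kappa> v)" "holds_conj (alive D) \<mu> (snd q)"
        unfolding holds_cq_def by blast
      \<comment> \<open>A quantified variable absent from the conjunction may take any value;
        \<open>f\<close> keeps it inside the searched range.\<close>
      define \<nu> where "\<nu> v = (if v \<in> set (fst q) - vars_conj (snd q) then f else \<mu> v)" for v
      have "holds_conj (alive D) \<nu> (snd q)"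
        using \<mu>(2) holds_conj_cong[of "snd q" \<nu> \<mu>] by (simp add: \<nu>_def)
      moreover have "\<nu> v \<in> insert f low" if v: "v \<in> set (fst q)" for v
      proof (cases "v \<in> vars_conj (snd q)")
        case True
        then have "v \<in> atom_vars (snd q)" using safe q v by blast
        then have "\<mu> v \<in> low" using atom_var_value[OF \<mu>(2)] alive_low by blast
        then show ?thesis by (simp add: \<nu>_def)
      qed (simp add: \<nu>_def v)
      ultimately show "\<exists>\<nu>. (\<forall>v\<in>set (fst q). \<nu> v \<in> insert f low) \<and>
          (\<forall>v. v \<notin> set (fst q) \<longrightarrow> \<nu> v = val \<rho> (\<kappa> v)) \<and> holds_conj (alive D) \<nu> (snd q)"
        using \<mu>(1) by (intro exI[of _ \<nu>]) (auto simp: \<nu>_def)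
    qed (auto simp: holds_cq_def)
    finally show ?thesis .
  qed
  then show ?thesis by (simp add: ucqf_def holds_ucq_def)
qed

lemma sem_violf:
  assumes k: "k < length fs" "fs ! k = (p, as)" "\<rho> a = offs fs k" "a < d"
    and \<Delta>: "\<forall>\<delta>\<in>set \<Delta>. wf_dep ar \<delta> \<and> consts_conj (fst \<delta>) \<subseteq> set C \<and> consts_ucq (snd \<delta>) \<subseteq> set C"
  shows "sem w D \<rho> (violf C a d \<Delta>) \<longleftrightarrow> violates (set \<Delta>) (alive D) (Pr p, as)"
proof -
  have "sem w D \<rho> (exf C (dep_vars \<delta>) (\<lambda>_. FrC) d
      (\<lambda>\<kappa> d. And (conjf (fact_atf a) \<kappa> d (fst \<delta>)) (Neg (ucqf C \<kappa> d (snd \<delta>))))) \<longleftrightarrow>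
     (\<exists>\<nu>. holds_conj {(Pr p, as)} \<nu> (fst \<delta>) \<and> \<not> holds_ucq (alive D) \<nu> (snd \<delta>))"
    if \<delta>: "\<delta> \<in> set \<Delta>" for \<delta>
  proof -
    have wd: "wf_dep ar \<delta>" "consts_conj (fst \<delta>) \<subseteq> set C" "consts_ucq (snd \<delta>) \<subseteq> set C"
      using \<Delta> \<delta> by auto
    have vs: "set (dep_vars \<delta>) = vars_conj (fst \<delta>) \<union> fv_ucq (snd \<delta>)"
      by (simp add: dep_vars_def finite_vars)
    let ?B = "\<lambda>\<nu>. holds_conj {(Pr p, as)} \<nu> (fst \<delta>) \<and> \<not> holds_ucq (alive D) \<nu> (snd \<delta>)"
    have "sem w D \<rho>' (And (conjf (fact_atf a) \<kappa> d' (fst \<delta>)) (Neg (ucqf C \<kappa> d' (snd \<delta>)))) \<longleftrightarrow>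
        ?B (\<lambda>v. val \<rho>' (\<kappa> v))"
      if v: "\<forall>v. valid \<rho>' d' (\<kappa> v)" "\<forall>x<d. \<rho>' x = \<rho> x" "d \<le> d'" for \<kappa> d' \<rho>'
    proof -
      have "sem w D \<rho>' (conjf (fact_atf a) \<kappa> d' (fst \<delta>)) \<longleftrightarrow> holds_conj {(Pr p, as)} (\<lambda>v. val \<rho>' (\<kappa> v)) (fst \<delta>)"
        using v k wd sem_fact_atf[OF k(1,2), of \<rho>' a d']
        by (intro sem_conjf) (auto simp: wf_dep_def)
      moreover have "sem w D \<rho>' (ucqf C \<kappa> d' (snd \<delta>)) \<longleftrightarrow> holds_ucq (alive D) (\<lambda>v. val \<rho>' (\<kappa> v)) (snd \<delta>)"
        using v(1) wd by (intro sem_ucqf) (auto simp: wf_dep_def)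
      ultimately show ?thesis by simp
    qed
    then have "sem w D \<rho> (exf C (dep_vars \<delta>) (\<lambda>_. FrC) d
      (\<lambda>\<kappa> d. And (conjf (fact_atf a) \<kappa> d (fst \<delta>)) (Neg (ucqf C \<kappa> d (snd \<delta>))))) \<longleftrightarrow>
      (\<exists>\<nu>. (\<forall>v\<in>set (dep_vars \<delta>). \<nu> v \<in> insert f low) \<and> (\<forall>v. v \<notin> set (dep_vars \<delta>) \<longrightarrow> \<nu> v = val \<rho> FrC) \<and> ?B \<nu>)"
      by (intro sem_exf[where e = d and \<rho> = \<rho>]) auto
    also have "\<dots> \<longleftrightarrow> (\<exists>\<nu>. ?B \<nu>)"
    proof
      assume "\<exists>\<nu>. ?B \<nu>"
      then obtain \<nu> where \<nu>: "holds_conj {(Pr p, as)} \<nu> (fst \<delta>)" "\<not> holds_ucq (alive D) \<nu> (snd \<delta>)" by blast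
      \<comment> \<open>Body variables have values in \<open>low\<close> and are unchanged; other
        values of free head variables collapse to \<open>f\<close>.\<close>
      define \<nu>' where "\<nu>' v = (if v \<in> set (dep_vars \<delta>) \<and> \<nu> v \<in> low then \<nu> v else f)" for v
      \<comment> \<open>The inspected fact may itself be dead in \<open>D\<close>, so its constants
        are located through the full database.\<close>
      have "(Pr p, as) \<in> alive {}" using k by (auto simp: alive_def)
      then have "set as \<subseteq> low" using alive_low by fastforce
      then have "\<nu> v \<in> low" if "v \<in> vars_conj (fst \<delta>)" for v
        using atom_var_value[OF \<nu>(1), of v] that wd(1) by (auto simp: wf_dep_def)
      then have "holds_conj {(Pr p, as)} \<nu>' (fst \<delta>)"
        using \<nu>(1) holds_conj_cong[of "fst \<delta>" \<nu>' \<nu>] vs by (auto simp: \<nu>'_def)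
      moreover have "\<not> holds_ucq (alive D) \<nu>' (snd \<delta>)"
      proof
        assume "holds_ucq (alive D) \<nu>' (snd \<delta>)"
        then have "holds_ucq (alive D) \<nu> (snd \<delta>)"
          using wd alive_low fresh_low vs
          by (elim holds_ucq_collapse[where L = low and f = f]) (auto simp: wf_dep_def low_def \<nu>'_def)
        then show False using \<nu>(2) by simp
      qed
      ultimately show "\<exists>\<nu>. (\<forall>v\<in>set (dep_vars \<delta>). \<nu> v \<in> insert f low) \<and>
          (\<forall>v. v \<notin> set (dep_vars \<delta>) \<longrightarrow> \<nu> v = val \<rho> FrC) \<and> ?B \<nu>"
        by (intro exI[of _ \<nu>']) (auto simp: \<nu>'_def)
    qed blast
    finally show ?thesis .
  qed
  then show ?thesis by (simp add: violf_def violates_def)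
qed

end

section \<open>The decision procedure\<close>

definition kill :: prog where
  "kill = Sw (\<lambda>_ _ _. False) 1 (\<lambda>_ _ X. 1 \<in> X \<or> 7 \<in> X)"

text \<open>Both outcomes answer False, so the surrounding loops never stop early. Pointer variable
  0 is the pass counter on track 6, variable 1 the inspected fact on track 7.\<close>

definition check_fact :: "nat list \<Rightarrow> dep list \<Rightarrow> prog" where
  "check_fact C \<Delta> = Cond (tr (And (startf 1 2) (violf C 1 2 \<Delta>))) kill FFp"

text \<open>Track 6 only counts the passes over all facts; as many passes as there are positions
  suffice, since every pass before stabilization kills a position.\<close>

definition decider :: "nat list \<Rightarrow> dep list \<Rightarrow> ucq \<Rightarrow> prog" where
  "decider C \<Delta> Q = seqp (Any 6 (Any 7 (check_fact C \<Delta>))) (tr (ucqf C (\<lambda>_. FrC) 0 Q))"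

lemma wfm_check: "wfm 2 (And (startf 1 2) (violf C 1 2 \<Delta>))"
  by (simp add: wfm_startf wfm_violf)

lemma writes_check: "writes (check_fact C \<Delta>) \<subseteq> {1..5} \<union> {8..}"
  using writes_tr[OF wfm_check[of C \<Delta>]] by (auto simp: check_fact_def kill_def)

lemma wf_check: "wf_prog (check_fact C \<Delta>)"
  using wf_tr[OF wfm_check[of C \<Delta>]] by (simp add: check_fact_def kill_def)

lemma wfm_query: "wfm 0 (ucqf C (\<lambda>_. FrC) 0 Q)"
  by (simp add: wfm_ucqf)

lemma wf_decider: "wf_prog (decider C \<Delta> Q)"
  using writes_check[of C \<Delta>] wf_check[of C \<Delta>] wf_tr[OF wfm_query[of C Q]]
  by (auto simp: decider_def)

lemma writes_decider: "\<exists>K>0. writes (decider C \<Delta> Q) \<subseteq> {0<..<K}"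
proof -
  have "0 \<notin> writes (decider C \<Delta> Q)"
    using writes_check[of C \<Delta>] writes_tr[OF wfm_query[of C Q]] by (auto simp: decider_def)
  moreover have "x < Suc (Max (writes (decider C \<Delta> Q)))" if "x \<in> writes (decider C \<Delta> Q)" for x
    using that finite_writes[of "decider C \<Delta> Q"] by (simp add: le_imp_less_Suc)
  ultimately show ?thesis
    by (intro exI[of _ "Suc (Max (writes (decider C \<Delta> Q)))"]) (auto intro: gr0I)
qed

section \<open>Correctness of the deletion passes\<close>

locale repair_run = database fs ar C f w for fs ar C f w +
  fixes \<Delta> :: "dep list"
  assumes \<Delta>: "\<delta> \<in> set \<Delta> \<Longrightarrow> wf_dep ar \<delta> \<and> linear_dep \<delta> \<and>
    consts_conj (fst \<delta>) \<subseteq> set C \<and> consts_ucq (snd \<delta>) \<subseteq> set C"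
begin

abbreviation fact_no :: "nat \<Rightarrow> fact" where
  "fact_no k \<equiv> (Pr (fst (fs ! k)), snd (fs ! k))"

definition bad :: "nat set \<Rightarrow> nat \<Rightarrow> bool" where
  "bad D p \<longleftrightarrow> (\<exists>k<length fs. p = offs fs k \<and> violates (set \<Delta>) (alive D) (fact_no k))"

text \<open>A deletion takes effect at once for the rest of the pass, as it does on the
  tape.\<close>

primrec pass :: "nat list \<Rightarrow> nat set \<Rightarrow> nat set" where
  "pass [] D = D"
| "pass (p # ps) D = pass ps (if bad D p then insert p D else D)"

lemma exec_check:
  assumes "\<sigma> 6 = {r}" "\<sigma> 7 = {a}" "r < n" "a < n" "\<sigma> 1 \<subseteq> {..<n}"
  shows "\<exists>\<sigma>'. exec w (check_fact C \<Delta>) \<sigma> = (False, \<sigma>') \<and> \<sigma>' 6 = {r} \<and>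
    \<sigma>' 1 = (if bad (\<sigma> 1) a then insert a (\<sigma> 1) else \<sigma> 1)"
proof -
  let ?\<phi> = "And (startf 1 2) (violf C 1 2 \<Delta>)"
  define \<rho> where "\<rho> x = (if x = 0 then r else a)" for x :: nat
  have env: "env 2 \<rho> \<sigma>" using assms by (auto simp: env_def \<rho>_def less_Suc_eq numeral_2_eq_2)
  have "sem w (\<sigma> 1) \<rho> (violf C 1 2 \<Delta>) \<longleftrightarrow> violates (set \<Delta>) (alive (\<sigma> 1)) (fact_no k)"
    if "k < length fs" "a = offs fs k" for k
    using that \<Delta> by (intro sem_violf) (auto simp: \<rho>_def)
  then have sem: "sem w (\<sigma> 1) \<rho> ?\<phi> \<longleftrightarrow> bad (\<sigma> 1) a"
    using sem_startf[of 1 2 \<rho> "\<sigma> 1"] assms(4) by (auto simp: bad_def \<rho>_def)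
  define \<sigma>1 where "\<sigma>1 = snd (exec w (tr ?\<phi>) \<sigma>)"
  have e1: "exec w (tr ?\<phi>) \<sigma> = (bad (\<sigma> 1) a, \<sigma>1)"
    unfolding \<sigma>1_def sem[symmetric] tr_correct[OF wfm_check[of C \<Delta>] env, symmetric] by simp
  have s1: "\<sigma>1 6 = {r}" "\<sigma>1 7 = {a}" "\<sigma>1 1 = \<sigma> 1"
    using tr_preserves[OF wfm_check[of C \<Delta>] env] e1 by (auto simp: env_def \<rho>_def dest: spec[of _ 0] spec[of _ 1])
  have "{i. i < n \<and> (i \<in> \<sigma>1 1 \<or> i \<in> \<sigma>1 7)} = insert a (\<sigma> 1)" using s1 assms by auto
  moreover have "st (\<lambda>_ _ _. False) w \<sigma>1 i = False" for i by (cases i) auto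
  ultimately have "exec w kill \<sigma>1 = (False, \<sigma>1(1 := insert a (\<sigma> 1)))"
    by (simp add: kill_def marks_def)
  then have "exec w (check_fact C \<Delta>) \<sigma> =
      (False, if bad (\<sigma> 1) a then \<sigma>1(1 := insert a (\<sigma> 1)) else \<sigma>1(2 := {}))"
    unfolding check_fact_def exec_Cond e1 exec_tst fst_conv snd_conv by simp
  then show ?thesis using s1 by auto
qed

lemma pass_bound: "D \<subseteq> {..<n} \<Longrightarrow> set ps \<subseteq> {..<n} \<Longrightarrow> pass ps D \<subseteq> {..<n}"
  by (induction ps arbitrary: D) auto

lemma exec_inner:
  assumes "\<sigma> 6 = {r}" "r < n" "\<sigma> 1 \<subseteq> {..<n}" "set ps \<subseteq> {..<n}"
  shows "\<exists>\<sigma>'. iter 7 (exec w (check_fact C \<Delta>)) ps \<sigma> = (False, \<sigma>') \<and> \<sigma>' 6 = {r} \<and> \<sigma>' 1 = pass ps (\<sigma> 1)"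
  using assms
proof (induction ps arbitrary: \<sigma>)
  case (Cons p ps)
  obtain \<sigma>1 where 1: "exec w (check_fact C \<Delta>) (\<sigma>(7 := {p})) = (False, \<sigma>1)" "\<sigma>1 6 = {r}"
    "\<sigma>1 1 = (if bad (\<sigma> 1) p then insert p (\<sigma> 1) else \<sigma> 1)"
    using Cons.prems exec_check[of "\<sigma>(7 := {p})" r p] by auto
  have "\<exists>\<sigma>'. iter 7 (exec w (check_fact C \<Delta>)) ps \<sigma>1 = (False, \<sigma>') \<and> \<sigma>' 6 = {r} \<and> \<sigma>' 1 = pass ps (\<sigma>1 1)"
    using Cons.prems 1 by (intro Cons.IH) auto
  then show ?case unfolding iter.simps pass.simps 1 prod.case if_False .
qed simp

lemma exec_outer:
  assumes "\<sigma> 1 \<subseteq> {..<n}" "set ps \<subseteq> {..<n}"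
  shows "snd (iter 6 (exec w (Any 7 (check_fact C \<Delta>))) ps \<sigma>) 1 = (pass [0..<n] ^^ length ps) (\<sigma> 1)"
  using assms
proof (induction ps arbitrary: \<sigma>)
  case (Cons p ps)
  obtain \<sigma>1 where 1: "exec w (Any 7 (check_fact C \<Delta>)) (\<sigma>(6 := {p})) = (False, \<sigma>1)"
    "\<sigma>1 1 = pass [0..<n] (\<sigma> 1)"
    using exec_inner[of "\<sigma>(6 := {p})" p "[0..<n]"] Cons.prems by (auto simp: atLeast0LessThan)
  have "pass [0..<n] (\<sigma> 1) \<subseteq> {..<n}" using Cons.prems by (intro pass_bound) auto
  then show ?case using Cons.IH[of \<sigma>1] Cons.prems 1 by (simp add: funpow_swap1 del: exec.simps)
qed simp

lemma pass_mono: "D \<subseteq> pass ps D"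
  by (induction ps arbitrary: D) (auto simp: subset_iff)

text \<open>A pass only adds positions, so if it ends where it began, nothing was added in between
  and every position was tested against \<open>D\<close> itself.\<close>

lemma pass_fixed: "pass ps D = D \<Longrightarrow> p \<in> set ps \<Longrightarrow> bad D p \<Longrightarrow> p \<in> D"
proof (induction ps)
  case (Cons q ps)
  have "(if bad D q then insert q D else D) \<subseteq> D"
    using pass_mono[of "if bad D q then insert q D else D" ps] Cons.prems(1) by simp
  then have q: "(if bad D q then insert q D else D) = D" by (auto split: if_splits)
  then have "pass ps D = D" using Cons.prems(1) by simp
  moreover have "bad D q \<Longrightarrow> q \<in> D" using q by (auto split: if_splits)
  ultimately show ?case using Cons.IH Cons.prems(2,3) by auto
qed simp

lemma pass_stable: "(\<forall>p. bad D p \<longrightarrow> p \<in> D) \<Longrightarrow> pass ps D = D"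
  by (induction ps) (auto simp: insert_absorb)

lemma linear: "\<forall>\<delta>\<in>set \<Delta>. linear_dep \<delta>"
  using \<Delta> by blast

lemma consistent_alive_iff: "consistent (set \<Delta>) (alive D) \<longleftrightarrow> (\<forall>p. bad D p \<longrightarrow> p \<in> D)"
proof -
  have "alive D = {fact_no k | k. k < length fs \<and> offs fs k \<notin> D}"
    by (force simp: alive_def)
  then show ?thesis unfolding consistent_iff[OF linear] bad_def by auto
qed

lemma alive_empty: "alive {} = db_of fs"
  by (force simp: alive_def db_of_def in_set_conv_nth)

lemma alive_subset: "alive D \<subseteq> db_of fs"
  unfolding alive_empty[symmetric] by (auto simp: alive_def)

text \<open>By antitonicity no fact of the maximal consistent set is violated in the larger
  \<open>alive D\<close>, so the deleted position carries a different fact and their occurrences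
  remain.\<close>

lemma max_consistent_insert:
  assumes "max_consistent (set \<Delta>) E \<subseteq> alive D" "bad D p"
  shows "max_consistent (set \<Delta>) E \<subseteq> alive (insert p D)"
proof
  fix x assume x: "x \<in> max_consistent (set \<Delta>) E"
  then have "x \<in> alive D" using assms(1) by blast
  then obtain l where l: "x = fact_no l" "l < length fs" "offs fs l \<notin> D" by (force simp: alive_def)
  obtain k where k: "k < length fs" "p = offs fs k" "violates (set \<Delta>) (alive D) (fact_no k)"
    using assms(2) by (auto simp: bad_def)
  have "\<not> violates (set \<Delta>) (max_consistent (set \<Delta>) E) x"
    using consistent_max[OF linear] x unfolding consistent_iff[OF linear] by blast
  then have "\<not> violates (set \<Delta>) (alive D) x" using violates_antimono assms(1) by blast
  then have "k \<noteq> l" using k(3) l(1) by auto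
  then have "offs fs l \<noteq> p" using offs_inj k l by blast
  then show "x \<in> alive (insert p D)" using l by (force simp: alive_def)
qed

lemma max_consistent_pass:
  "max_consistent (set \<Delta>) E \<subseteq> alive D \<Longrightarrow> max_consistent (set \<Delta>) E \<subseteq> alive (pass ps D)"
  by (induction ps arbitrary: D) (auto simp: max_consistent_insert)

text \<open>The first conjunct says that no fact of the repair is lost, the last one measures
  progress by the number of dead positions.\<close>

lemma passes:
  "max_consistent (set \<Delta>) (db_of fs) \<subseteq> alive ((pass [0..<n] ^^ m) {}) \<and>
   (pass [0..<n] ^^ m) {} \<subseteq> {..<n} \<and>
   (consistent (set \<Delta>) (alive ((pass [0..<n] ^^ m) {})) \<or> m \<le> card ((pass [0..<n] ^^ m) {}))"
proof (induction m)
  case 0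
  show ?case by (auto simp: alive_empty max_consistent_def)
next
  case (Suc m)
  define D where "D = (pass [0..<n] ^^ m) {}"
  define D' where "D' = pass [0..<n] D"
  have b: "D' \<subseteq> {..<n}" using Suc unfolding D'_def D_def by (intro pass_bound) auto
  have "consistent (set \<Delta>) (alive D') \<or> Suc m \<le> card D'"
  proof (cases "consistent (set \<Delta>) (alive D)")
    case True
    then show ?thesis using pass_stable unfolding consistent_alive_iff D'_def by simp
  next
    case False
    then obtain p where p: "bad D p" "p \<notin> D" unfolding consistent_alive_iff by blast
    then have "p < n" using offs_less by (auto simp: bad_def w_def)
    then have "D' \<noteq> D" using pass_fixed[of "[0..<n]" D p] p unfolding D'_def by auto
    then have "D \<subset> D'" using pass_mono unfolding D'_def by blast
    then have "card D < card D'" using b finite_subset psubset_card_mono by blast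
    then show ?thesis using Suc False by (simp add: D_def)
  qed
  moreover have "max_consistent (set \<Delta>) (db_of fs) \<subseteq> alive D'"
    using Suc max_consistent_pass unfolding D'_def D_def by blast
  ultimately show ?case using b by (simp add: D_def D'_def)
qed

lemma alive_passes: "alive ((pass [0..<n] ^^ n) {}) = max_consistent (set \<Delta>) (db_of fs)"
proof -
  define D where "D = (pass [0..<n] ^^ n) {}"
  have D: "max_consistent (set \<Delta>) (db_of fs) \<subseteq> alive D" "D \<subseteq> {..<n}"
    "consistent (set \<Delta>) (alive D) \<or> n \<le> card D"
    using passes[of n] by (simp_all add: D_def)
  have "consistent (set \<Delta>) (alive D)"
  proof (cases "n \<le> card D")
    case True
    \<comment> \<open>With every position dead nothing is alive, and consistency is trivial.\<close>
    then have "D = {..<n}" using D(2) by (intro card_seteq) auto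
    then show ?thesis using offs_less by (auto simp: consistent_alive_iff bad_def w_def)
  qed (use D(3) in simp)
  then have "alive D \<subseteq> max_consistent (set \<Delta>) (db_of fs)"
    using alive_subset by (auto simp: max_consistent_def)
  then show ?thesis using D(1) by (simp add: D_def)
qed

lemma exec_decider:
  assumes "safe_bucq ar Q" "consts_ucq Q \<subseteq> set C"
  shows "fst (exec w (decider C \<Delta> Q) init_tracks) \<longleftrightarrow> IAR_entails (set \<Delta>) (db_of fs) Q"
proof -
  let ?\<sigma> = "snd (exec w (Any 6 (Any 7 (check_fact C \<Delta>))) init_tracks)"
  have "?\<sigma> 1 = (pass [0..<n] ^^ n) {}"
    using exec_outer[of init_tracks "[0..<n]"] by (simp add: init_tracks_def atLeast0LessThan)
  then have \<sigma>: "alive (?\<sigma> 1) = max_consistent (set \<Delta>) (db_of fs)" using alive_passes by simp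
  have Q: "wf_ucq ar Q" "fv_ucq Q = {}" "\<forall>q\<in>set Q. safe_cq q"
    using assms(1) by (auto simp: safe_bucq_def)
  \<comment> \<open>At depth 0 no pointer is in scope, so whatever the deletion loops left on the
    other tracks is irrelevant.\<close>
  have "fst (exec w (decider C \<Delta> Q) init_tracks) = sem w (?\<sigma> 1) (\<lambda>_. 0) (ucqf C (\<lambda>_. FrC) 0 Q)"
    unfolding decider_def exec_seqp by (intro tr_correct[OF wfm_query]) (simp add: env_def)
  also have "\<dots> \<longleftrightarrow> holds_ucq (alive (?\<sigma> 1)) (\<lambda>v. val (\<lambda>_. 0) FrC) Q"
    using Q assms(2) by (intro sem_ucqf) (auto simp: safe_cq_def)
  \<comment> \<open>The formula evaluates under the constant assignment \<open>f\<close>,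
    \<open>sat_bucq\<close> under 0; without free variables both agree.\<close>
  also have "\<dots> \<longleftrightarrow> sat_bucq (alive (?\<sigma> 1)) Q"
  proof -
    have "holds_cq F \<nu> q \<Longrightarrow> holds_cq F \<nu>' q" if q: "q \<in> set Q" for F \<nu> \<nu>' q
    proof -
      assume "holds_cq F \<nu> q"
      then obtain \<mu> where \<mu>: "holds_conj F \<mu> (snd q)" unfolding holds_cq_def by blast
      have "vars_conj (snd q) \<subseteq> set (fst q)" using Q(2) q by (auto simp: fv_ucq_def fv_cq_def)
      then have "holds_conj F (\<lambda>v. if v \<in> set (fst q) then \<mu> v else \<nu>' v) (snd q)"
        by (intro holds_conj_cong[THEN iffD1, OF _ \<mu>]) auto
      then show "holds_cq F \<nu>' q" unfolding holds_cq_def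
        by (intro exI[of _ "\<lambda>v. if v \<in> set (fst q) then \<mu> v else \<nu>' v"]) simp
    qed
    then show ?thesis unfolding sat_bucq_def holds_ucq_def by blast
  qed
  finally show ?thesis unfolding \<sigma> IAR_entails_iff[OF linear] .
qed

end

text \<open>Numerals are injective and only finitely many strings occur in \<open>w\<close>. The
  value varies with the database, but the program knows it only as \<open>FrC\<close>.\<close>

lemma fresh_value: "\<exists>f. f \<notin> set C \<and> (\<forall>i<length w. strg w (Suc i) \<noteq> bin f)"
proof -
  have "inj bin" using bin_inject by (auto intro: injI)
  then have "finite (bin -` ((\<lambda>i. strg w (Suc i)) ` {..<length w}))" by (intro finite_vimageI) auto
  then obtain f where "f \<notin> set C \<union> bin -` ((\<lambda>i. strg w (Suc i)) ` {..<length w})"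
    using ex_new_if_finite[OF infinite_UNIV_nat] by (metis finite_UnI finite_set)
  then have "f \<notin> set C" "bin f \<notin> (\<lambda>i. strg w (Suc i)) ` {..<length w}" by auto
  then show ?thesis by (metis imageI lessThan_iff)
qed

theorem theorem12:
  fixes ar :: "nat \<Rightarrow> nat" and \<Sigma> :: "dep set" and Q :: ucq
  assumes "finite \<Sigma>"
    and "\<forall>d\<in>\<Sigma>. wf_dep ar d \<and> linear_dep d"
    and "safe_bucq ar Q"
  shows "IAR_in_PTIME_data ar \<Sigma> Q"
proof -
  obtain \<Delta> where \<Delta>: "set \<Delta> = \<Sigma>" using finite_list[OF assms(1)] by blast
  have "finite (consts_ucq Q \<union> (\<Union>d\<in>\<Sigma>. consts_conj (fst d) \<union> consts_ucq (snd d)))"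
    using assms(1) by (simp add: finite_consts)
  from finite_list[OF this] obtain C where C: "set C = consts_ucq Q \<union> (\<Union>d\<in>\<Sigma>. consts_conj (fst d) \<union> consts_ucq (snd d))"
    by (rule exE)
  let ?P = "decider C \<Delta> Q"
  obtain K where K: "0 < K" "writes ?P \<subseteq> {0<..<K}" using writes_decider by blast
  obtain c k where ck: "\<forall>n\<ge>1. cost n ?P \<le> c * n ^ k" using cost_polynomial by blast
  define e where "e = IAR_entails \<Sigma> (db_of []) Q"
  let ?M = "machine ?P K e"
  \<comment> \<open>\<open>Suc c\<close> instead of \<open>c\<close> leaves time for the step that
    marks the origin, and for the single step on the empty word.\<close>
  have run: "fst (run ?M (Suc c * length (enc_db fs) ^ k + Suc c) (0, [], enc_db fs)) =
      (if IAR_entails \<Sigma> (db_of fs) Q then 1 else 2)" if wf: "wf_db_list ar fs" for fs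
  proof (cases "fs = []")
    case True
    let ?q = "if e then 1 else 2"
    have "run ?M 1 (0, [], []) = (?q, [], [0])" by (simp add: run_def machine_def)
    then have "reach ?M (0, [], []) 1 (?q, [], [0])" unfolding reach_def by blast
    from reach_halted[OF this] have "run ?M (Suc c * length (enc_db fs) ^ k + Suc c) (0, [], []) = (?q, [], [0])"
      by (simp add: machine_def)
    then show ?thesis using True by (simp add: e_def enc_db_def)
  next
    case False
    let ?w = "enc_db fs"
    obtain f where f: "f \<notin> set C" "\<forall>i<length ?w. strg ?w (Suc i) \<noteq> bin f" using fresh_value by blast
    interpret repair_run fs ar C f ?w \<Delta>
      using False wf f assms(2) C \<Delta> by unfold_locales auto
    have "cost (length ?w) ?P \<le> c * length ?w ^ k" using n_pos by (intro ck[rule_format]) linarith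
    then have "1 + cost (length ?w) ?P \<le> Suc c * length ?w ^ k + Suc c" by simp
    moreover have "fst (exec ?w ?P init_tracks) \<longleftrightarrow> IAR_entails \<Sigma> (db_of fs) Q"
      unfolding \<open>set \<Delta> = \<Sigma>\<close>[symmetric] by (rule exec_decider[OF assms(3)]) (simp add: C)
    ultimately show ?thesis using machine_correct[OF K(2,1) wf_decider] by simp
  qed
  have "wf_tm ?M" using wf_machine K by blast
  moreover have "acc_st ?M = 1" "rej_st ?M = 2" by (simp_all add: machine_def)
  ultimately show ?thesis unfolding IAR_in_PTIME_data_def Let_def
    using run by (intro exI[of _ ?M] exI[of _ "Suc c"] exI[of _ k]) auto
qed

end
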